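(* Let $\vec p=(p_1,p_2)$ satisfy $1<p_-\le p_+<\infty$, and let $\vec a,\vec b,\vec c\in\mathbb{R}^2$, $\vec\alpha\in(-1,\infty)^2$. Then the following are equivalent: (1) $S_{\vec a,\vec b,\vec c}$ is bounded from $L^{\vec p}_{\vec\alpha}(T_B\times T_B)$ to $L^\infty(T_B\times T_B)$; (2) $T_{\vec a,\vec b,\vec c}$ is bounded from $L^{\vec p}_{\vec\alpha}(T_B\times T_B)$ to $L^\infty(T_B\times T_B)$; (3) for each $i\in\{1,2\}$: $a_i>0$, $\alpha_i+1<p_i(b_i+1)$, and $c_i=n+1+a_i+b_i-\frac{n+1+\alpha_i}{p_i}$.
   Context: Let $n$ be a positive integer. For $z=(z_1,\dots,z_n)\in\mathbb{C}^n$ write $z=x+iy$ with $x,y\in\mathbb{R}^n$, $z'=(z_1,\dots,z_{n-1})$, $y'=(y_1,\dots,y_{n-1})$. Let $B=\{y\in\mathbb{R}^n: |y'|^2<y_n\}$ and $T_B=\{x+iy: x\in\mathbb{R}^n, y\in B\}$. For $z\in T_B$ put $\rho(z)=y_n-|y'|^2>0$, and for $z,u\in T_B$ put $\rho(z,u)=\frac14\big(\sum_{j=1}^{n-1}(z_j-\overline{u_j})^2-2i(z_n-\overline{u_n})\big)$; this has positive real part, and complex powers $\rho(z,u)^c$ are taken with the principal branch. $dV$ is Lebesgue measure on $\mathbb{C}^n$ and $dV_\alpha(z)=\rho(z)^\alpha dV(z)$. For $\vec p=(p_1,p_2)\in[1,\infty]^2$ and $\vec\alpha=(\alpha_1,\alpha_2)$,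 $L^{\vec p}_{\vec\alpha}(T_B\times T_B)$ is the space of measurable $f$ on $T_B\times T_B$ with finite mixed norm $\|f\|_{\vec p,\vec\alpha}=\big\{\int_{T_B}\big(\int_{T_B}|f(z,w)|^{p_1}dV_{\alpha_1}(z)\big)^{p_2/p_1}dV_{\alpha_2}(w)\big\}^{1/p_2}$, with the inner (resp. outer) integral replaced by an essential supremum in $z$ (resp. $w$) when $p_1=\infty$ (resp. $p_2=\infty$); when $\vec p=(\infty,\infty)$ this is $L^\infty(T_B\times T_B)$. Write $p_-=\min\{p_1,p_2\}$, $p_+=\max\{p_1,p_2\}$, and similarly $q_\pm$. For $\vec a=(a_1,a_2),\vec b=(b_1,b_2),\vec c=(c_1,c_2)\in\mathbb{R}^2$, $T_{\vec a,\vec b,\vec c}f(z,w)=\rho(z)^{a_1}\rho(w)^{a_2}\int_{T_B}\int_{T_B}\frac{\rho(u)^{b_1}\rho(\eta)^{b_2}}{\rho(z,u)^{c_1}\rho(w,\eta)^{c_2}}f(u,\eta)\,dV(u)\,dV(\eta)$ and $S_{\vec a,\vec b,\vec c}f(z,w)=\rho(z)^{a_1}\rho(w)^{a_2}\int_{T_B}\int_{T_B}\frac{\rho(u)^{b_1}\rho(\eta)^{b_2}}{|\rho(z,u)|^{c_1}|\rho(w,\eta)|^{c_2}}f(u,\eta)\,dV(u)\,dV(\eta)$. An operator is bounded from $X$ to $Y$ if for every $f\in X$ the defining integral converges for a.e. $(z,w)$ and $\|Tf\|_Y\le C\|f\|_X$ with $C$ independent of $f$. *)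

theory Defs
  imports "HOL-Analysis.Analysis"
begin

text \<open>Points of C^n are represented as extensional functions nat => complex on {..<n};
  coordinate j (0-based) is z_(j+1); the last coordinate z_n is z (n-1).
  Lebesgue measure dV on C^n is the finite product of lborel on complex.\<close>

definition Cn :: "nat \<Rightarrow> (nat \<Rightarrow> complex) measure" where
  "Cn n = PiM {..<n} (\<lambda>_. lborel)"

definition rho :: "nat \<Rightarrow> (nat \<Rightarrow> complex) \<Rightarrow> real" where
  "rho n z = Im (z (n - 1)) - (\<Sum>j<n - 1. (Im (z j))\<^sup>2)"

definition TB :: "nat \<Rightarrow> (nat \<Rightarrow> complex) set" where
  "TB n = {z \<in> space (Cn n). rho n z > 0}"

definition rho2 :: "nat \<Rightarrow> (nat \<Rightarrow> complex) \<Rightarrow> (nat \<Rightarrow> complex) \<Rightarrow> complex" where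
  "rho2 n z u = (1/4) * ((\<Sum>j<n - 1. (z j - cnj (u j))\<^sup>2) - 2 * \<i> * (z (n - 1) - cnj (u (n - 1))))"

definition VB :: "nat \<Rightarrow> (nat \<Rightarrow> complex) measure" where
  "VB n = restrict_space (Cn n) (TB n)"

definition VB2 :: "nat \<Rightarrow> ((nat \<Rightarrow> complex) \<times> (nat \<Rightarrow> complex)) measure" where
  "VB2 n = VB n \<Otimes>\<^sub>M VB n"

text \<open>Real power of an extended nonnegative real (for positive exponent r), with infinity^r = infinity.\<close>
definition epow :: "ennreal \<Rightarrow> real \<Rightarrow> ennreal" where
  "epow x r = (if x = \<infinity> then \<infinity> else ennreal (enn2real x powr r))"

definition mixed_norm ::
  "nat \<Rightarrow> real \<Rightarrow> real \<Rightarrow> real \<Rightarrow> real \<Rightarrow>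
   ((nat \<Rightarrow> complex) \<times> (nat \<Rightarrow> complex) \<Rightarrow> complex) \<Rightarrow> ennreal" where
  "mixed_norm n p1 p2 al1 al2 f =
     epow (\<integral>\<^sup>+ w. epow (\<integral>\<^sup>+ z. ennreal (norm (f (z, w)) powr p1 * rho n z powr al1) \<partial>VB n) (p2 / p1)
                     * ennreal (rho n w powr al2) \<partial>VB n) (1 / p2)"

definition kerT :: "nat \<Rightarrow> real \<Rightarrow> real \<Rightarrow> real \<Rightarrow> real \<Rightarrow> real \<Rightarrow> real \<Rightarrow>
   (nat \<Rightarrow> complex) \<times> (nat \<Rightarrow> complex) \<Rightarrow> (nat \<Rightarrow> complex) \<times> (nat \<Rightarrow> complex) \<Rightarrow> complex" where
  "kerT n a1 a2 b1 b2 c1 c2 zw ue =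
     (case zw of (z, w) \<Rightarrow> case ue of (u, e) \<Rightarrow>
       of_real (rho n z powr a1 * rho n w powr a2 * rho n u powr b1 * rho n e powr b2)
       / (rho2 n z u powr of_real c1 * rho2 n w e powr of_real c2))"

definition kerS :: "nat \<Rightarrow> real \<Rightarrow> real \<Rightarrow> real \<Rightarrow> real \<Rightarrow> real \<Rightarrow> real \<Rightarrow>
   (nat \<Rightarrow> complex) \<times> (nat \<Rightarrow> complex) \<Rightarrow> (nat \<Rightarrow> complex) \<times> (nat \<Rightarrow> complex) \<Rightarrow> complex" where
  "kerS n a1 a2 b1 b2 c1 c2 zw ue =
     (case zw of (z, w) \<Rightarrow> case ue of (u, e) \<Rightarrow>
       of_real (rho n z powr a1 * rho n w powr a2 * rho n u powr b1 * rho n e powr b2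
       / (cmod (rho2 n z u) powr c1 * cmod (rho2 n w e) powr c2)))"

definition intop ::
  "nat \<Rightarrow> (_ \<Rightarrow> _ \<Rightarrow> complex) \<Rightarrow> ((nat \<Rightarrow> complex) \<times> (nat \<Rightarrow> complex) \<Rightarrow> complex)
     \<Rightarrow> (nat \<Rightarrow> complex) \<times> (nat \<Rightarrow> complex) \<Rightarrow> complex" where
  "intop n K f zw = (\<integral> ue. K zw ue * f ue \<partial>VB2 n)"

definition bounded_mixed_to_Linf ::
  "nat \<Rightarrow> real \<Rightarrow> real \<Rightarrow> real \<Rightarrow> real \<Rightarrow> (_ \<Rightarrow> _ \<Rightarrow> complex) \<Rightarrow> bool" where
  "bounded_mixed_to_Linf n p1 p2 al1 al2 K \<longleftrightarrow>
     (\<exists>C::real. \<forall>f \<in> borel_measurable (VB2 n).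
        mixed_norm n p1 p2 al1 al2 f < \<infinity> \<longrightarrow>
          (AE zw in VB2 n. integrable (VB2 n) (\<lambda>ue. K zw ue * f ue)) \<and>
          (AE zw in VB2 n. ennreal (norm (intop n K f zw)) \<le> ennreal C * mixed_norm n p1 p2 al1 al2 f))"

end

theory Submission
  imports Defs "HOL-Complex_Analysis.Cauchy_Integral_Theorem"
begin

text \<open>
  The real part of \<open>\<rho>(z,u)\<close> equals \<open>|z' - u'|\<^sup>2/4 + (\<rho>(z) + \<rho>(u))/2\<close>, and its imaginary part is an affine
  function of \<open>Re u\<^sub>n\<close> with slope \<open>1/2\<close>. Integrating first over \<open>Re u\<^sub>n\<close>, then over \<open>u'\<close> with \<open>r = \<rho>(u)\<close>
  fixed, and finally over \<open>r\<close>, each step being a scaling, shows that the integral of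
  \<open>\<rho>(u)\<^sup>s |\<rho>(z,u)|\<^bsup>-t\<^esup>\<close> over \<open>T\<^sub>B\<close> is a positive constant times the power \<open>n + 1 + s - t\<close> of \<open>\<rho>(z)\<close>; the
  constant is finite iff \<open>s > -1\<close> and \<open>t > n + 1 + s\<close>.

  By Hoelder's inequality in each variable, S is bounded as soon as the kernel factors have bounded
  dual norms, uniformly in z and w; by the integral formula this is condition (3). Conversely,
  when z stays in a small neighbourhood of a point \<open>z\<^sub>0\<close>, the quotient \<open>\<rho>(z,u)/\<rho>(z\<^sub>0,u)\<close> is uniformly close
  to 1 for all u. Applying T to the conjugate phase of the kernel at \<open>(z\<^sub>0,w\<^sub>0)\<close> times
  \<open>g\<^sub>1(u) g\<^sub>2(\<eta>)\<close> therefore recovers, on a set of positive measure, the integrals of the absolute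
  values of the kernel factors against \<open>g\<^sub>1\<close> and \<open>g\<^sub>2\<close>, and the converse of Hoelder's inequality bounds the dual
  norms.
\<close>

section \<open>One-dimensional integrals\<close>

text \<open>Extended-real valued, so that the scaling identities stay valid when the integral
  diverges; sufficiency and necessity can then be read off from one formula.\<close>

definition quad_int :: "real \<Rightarrow> ennreal" where
  "quad_int \<tau> = (\<integral>\<^sup>+x. ennreal ((x\<^sup>2 / 4 + 1) powr (-\<tau>)) \<partial>lborel)"

text \<open>The substitution of \<open>m + sqrt B * x\<close> for \<open>x\<close> turns the base
  into \<open>B\<close> times the base of \<open>quad_int\<close>; the Jacobian
  \<open>sqrt B\<close> contributes the \<open>1/2\<close> in the exponent.\<close>

lemma nn_integral_quadratic_powr:
  assumes "B > 0"
  shows "(\<integral>\<^sup>+x. ennreal (((m - x)\<^sup>2 / 4 + B) powr (-\<tau>)) \<partial>lborel) = quad_int \<tau> * ennreal (B powr (1/2 - \<tau>))"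
proof -
  have eq: "(m - (m + sqrt B * x))\<^sup>2 / 4 + B = B * (x\<^sup>2 / 4 + 1)" for x
    using assms by (simp add: power_mult_distrib field_simps)
  have "(\<integral>\<^sup>+x. ennreal (((m - x)\<^sup>2 / 4 + B) powr (-\<tau>)) \<partial>lborel) =
      ennreal (sqrt B) * (\<integral>\<^sup>+x. ennreal (((m - (m + sqrt B * x))\<^sup>2 / 4 + B) powr (-\<tau>)) \<partial>lborel)"
    using assms by (subst nn_integral_real_affine[where c="sqrt B" and t=m]) auto
  also have "(\<integral>\<^sup>+x. ennreal (((m - (m + sqrt B * x))\<^sup>2 / 4 + B) powr (-\<tau>)) \<partial>lborel)
      = (\<integral>\<^sup>+x. ennreal (B powr (-\<tau>)) * ennreal ((x\<^sup>2 / 4 + 1) powr (-\<tau>)) \<partial>lborel)"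
    unfolding eq using assms by (intro nn_integral_cong) (simp add: powr_mult ennreal_mult')
  also have "\<dots> = ennreal (B powr (-\<tau>)) * quad_int \<tau>"
    unfolding quad_int_def by (rule nn_integral_cmult) simp
  also have "ennreal (sqrt B) * (ennreal (B powr (-\<tau>)) * quad_int \<tau>) = quad_int \<tau> * ennreal (B powr (1/2 - \<tau>))"
  proof -
    have "B powr (1/2 - \<tau>) = sqrt B * B powr (-\<tau>)"
      using assms powr_add[of B "1/2" "-\<tau>"] by (simp add: powr_half_sqrt)
    then show ?thesis using assms by (simp add: ennreal_mult' mult_ac)
  qed
  finally show ?thesis .
qed

lemma nn_integral_lborel_pos:
  fixes f :: "'a::euclidean_space \<Rightarrow> ennreal"
  assumes [measurable]: "f \<in> borel_measurable borel" and A: "A \<in> sets borel" "emeasure lborel A \<noteq> 0"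
    and pos: "\<And>x. x \<in> A \<Longrightarrow> f x > 0"
  shows "(\<integral>\<^sup>+x. f x \<partial>lborel) > 0"
proof (rule ccontr)
  assume "\<not> ?thesis"
  then have "AE x in lborel. f x = 0" by (simp add: nn_integral_0_iff_AE)
  then have "AE x in lborel. x \<notin> A" by eventually_elim (use pos in force)
  then have "emeasure lborel A = 0" using A(1) by (simp add: AE_iff_null_sets null_setsD1)
  then show False using A by simp
qed

lemma quad_int_pos: "quad_int \<tau> > 0"
  unfolding quad_int_def
  by (rule nn_integral_lborel_pos[where A=UNIV]) (auto simp: add_nonneg_pos less_le add_nonneg_eq_0_iff)

lemma has_integral_indicator_mult:
  fixes f :: "real \<Rightarrow> real"
  assumes "(f has_integral I) S"
  shows "((\<lambda>x. indicator S x * f x) has_integral I) UNIV"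
proof -
  have "(\<lambda>x. indicator S x * f x) = (\<lambda>x. if x \<in> S then f x else 0)" by auto
  then show ?thesis using assms by (simp add: has_integral_restrict_UNIV)
qed

lemma nn_integral_powr_to_inf:
  assumes "e < -1"
  shows "(\<integral>\<^sup>+x. indicator {1..} x * ennreal (x powr e) \<partial>lborel) < \<infinity>"
proof -
  have "(\<integral>\<^sup>+x. indicator {1..} x * ennreal (x powr e) \<partial>lborel) =
      (\<integral>\<^sup>+x. ennreal (indicator {1..} x * (x powr e)) \<partial>lborel)"
    by (intro nn_integral_cong) (auto split: split_indicator)
  also have "\<dots> = ennreal (- (1 powr (e + 1)) / (e + 1))"
    by (rule nn_integral_has_integral_lborel) (use has_integral_indicator_mult[OF has_integral_powr_to_inf[of e 1]] assms in auto)
  finally show ?thesis by simp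
qed

lemma nn_integral_powr_from_0:
  assumes "e > -1"
  shows "(\<integral>\<^sup>+x. indicator {0<..<1} x * ennreal (x powr e) \<partial>lborel) < \<infinity>"
proof -
  have "(\<integral>\<^sup>+x. indicator {0<..<1} x * ennreal (x powr e) \<partial>lborel) \<le>
      (\<integral>\<^sup>+x. ennreal (indicator {0..1} x * (x powr e)) \<partial>lborel)"
    by (intro nn_integral_mono) (auto split: split_indicator)
  also have "\<dots> = ennreal (1 powr (e + 1) / (e + 1))"
    by (rule nn_integral_has_integral_lborel) (use has_integral_indicator_mult[OF has_integral_powr_from_0[of e 1]] assms in auto)
  finally show ?thesis by (simp add: order_le_less_trans)
qed

text \<open>The integrand is at most 1 on \<open>{-1..1}\<close>. Outside, dropping the summand 1
  leaves a constant times the power \<open>-2 * \<tau>\<close> of \<open>|x|\<close>, which is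
  integrable at infinity.\<close>

lemma quad_int_finite:
  assumes "\<tau> > 1/2"
  shows "quad_int \<tau> < \<infinity>"
proof -
  let ?f = "\<lambda>x::real. ennreal ((x\<^sup>2 / 4 + 1) powr (-\<tau>))"
  let ?g = "\<lambda>x::real. indicator {1..} x * ennreal (x powr (-2*\<tau>))"
  define I where "I = (\<integral>\<^sup>+x. ?g x \<partial>lborel)"
  have I: "I < \<infinity>" unfolding I_def by (rule nn_integral_powr_to_inf) (use assms in simp)
  have refl: "(\<integral>\<^sup>+x. ?g (-x) \<partial>lborel) = I"
    unfolding I_def by (subst (2) nn_integral_real_affine[where c="-1" and t=0]) auto
  have bound: "?f x \<le> indicator {-1..1} x + (ennreal (4 powr \<tau>) * ?g x + ennreal (4 powr \<tau>) * ?g (-x))" for x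
  proof (cases "x \<in> {-1..1}")
    case True
    have "1 powr \<tau> \<le> (x\<^sup>2/4 + 1) powr \<tau>" by (rule powr_mono2) (use assms in auto)
    then have "(x\<^sup>2/4 + 1) powr (-\<tau>) \<le> 1" by (simp add: powr_minus inverse_le_1_iff)
    then have "?f x \<le> 1" by simp
    also have "(1::ennreal) = indicator {-1..1} x" using True by simp
    also have "\<dots> \<le> \<dots> + (ennreal (4 powr \<tau>) * ?g x + ennreal (4 powr \<tau>) * ?g (-x))" by (rule le_iff_add[THEN iffD2]) blast
    finally show ?thesis .
  next
    case False
    then have ax: "\<bar>x\<bar> > 1" by auto
    have "(x\<^sup>2/4 + 1) powr (-\<tau>) \<le> (x\<^sup>2/4) powr (-\<tau>)" 
      by (rule powr_mono2') (use assms ax in auto)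
    also have "(x\<^sup>2/4) powr (-\<tau>) = 4 powr \<tau> * \<bar>x\<bar> powr (-2*\<tau>)"
    proof -
      have "x\<^sup>2 = \<bar>x\<bar> powr 2" using ax by simp
      then show ?thesis using ax by (simp only: powr_divide) (simp add: powr_powr powr_minus field_simps del: powr_numeral)
    qed
    finally have "?f x \<le> ennreal (4 powr \<tau>) * ennreal (\<bar>x\<bar> powr (-2*\<tau>))"
      by (simp add: ennreal_leI flip: ennreal_mult')
    also have "\<dots> \<le> (ennreal (4 powr \<tau>) * ?g x + ennreal (4 powr \<tau>) * ?g (-x))"
      using ax by (cases "x > 0") auto
    also have "\<dots> \<le> indicator {-1..1} x + (ennreal (4 powr \<tau>) * ?g x + ennreal (4 powr \<tau>) * ?g (-x))"
      using False by simp
    finally show ?thesis .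
  qed
  have "quad_int \<tau> \<le> (\<integral>\<^sup>+x. indicator {-1..1} x + (ennreal (4 powr \<tau>) * ?g x + ennreal (4 powr \<tau>) * ?g (-x)) \<partial>lborel)"
    unfolding quad_int_def by (intro nn_integral_mono bound)
  also have "\<dots> = 2 + (ennreal (4 powr \<tau>) * I + ennreal (4 powr \<tau>) * I)"
    using refl I_def by (simp add: nn_integral_add nn_integral_cmult)
  also have "\<dots> < \<infinity>" using I by (simp add: ennreal_mult_less_top)
  finally show ?thesis .
qed

lemma nn_integral_inverse_Icc:
  assumes "0 < a" "a \<le> b"
  shows "(\<integral>\<^sup>+x. ennreal (1/x) * indicator {a..b} x \<partial>lborel) = ennreal (ln b - ln a)"
  using assms by (intro nn_integral_FTC_Icc) (auto intro!: derivative_eq_intros)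

text \<open>The sign of the exponent decides which endpoint of \<open>{y/2..y}\<close> is extreme;
  the constants with \<open>min\<close> and \<open>max\<close> cover both signs. The intended
  \<open>x\<close> is \<open>(1 + r)/2\<close>, comparable to 1 for small \<open>r\<close> and to
  \<open>r\<close> for large \<open>r\<close>.\<close>

lemma powr_half_bounds:
  fixes x y \<tau> :: real
  assumes "0 < y" "y/2 \<le> x" "x \<le> y"
  shows "min 1 (2 powr \<tau>) * y powr (-\<tau>) \<le> x powr (-\<tau>)" "x powr (-\<tau>) \<le> max 1 (2 powr \<tau>) * y powr (-\<tau>)"
proof -
  have h: "(y/2) powr (-\<tau>) = 2 powr \<tau> * y powr (-\<tau>)" using assms by (simp add: powr_divide powr_minus field_simps)
  have "min 1 (2 powr \<tau>) * y powr (-\<tau>) \<le> x powr (-\<tau>) \<and> x powr (-\<tau>) \<le> max 1 (2 powr \<tau>) * y powr (-\<tau>)"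
  proof (cases "\<tau> \<ge> 0")
    case True
    then have "y powr (-\<tau>) \<le> x powr (-\<tau>)" "x powr (-\<tau>) \<le> (y/2) powr (-\<tau>)"
      using assms by (auto intro!: powr_mono2')
    then show ?thesis using h True by (auto simp: min_def max_def ge_one_powr_ge_zero)
  next
    case False
    then have "x powr (-\<tau>) \<le> y powr (-\<tau>)" "(y/2) powr (-\<tau>) \<le> x powr (-\<tau>)"
      using assms by (auto intro!: powr_mono2)
    moreover have "2 powr \<tau> \<le> 1" using False powr_mono[of \<tau> 0 2] by simp
    ultimately show ?thesis using h by (auto simp: min_def max_def)
  qed
  then show "min 1 (2 powr \<tau>) * y powr (-\<tau>) \<le> x powr (-\<tau>)" "x powr (-\<tau>) \<le> max 1 (2 powr \<tau>) * y powr (-\<tau>)" by auto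
qed

text \<open>Up to the factor \<open>2 powr \<tau>\<close> this is Euler's integral for the Beta
  function at \<open>s + 1\<close> and \<open>\<tau> - s - 1\<close>.\<close>

definition beta_int :: "real \<Rightarrow> real \<Rightarrow> ennreal" where
  "beta_int s \<tau> = (\<integral>\<^sup>+r. indicator {0<..} r * ennreal (r powr s * ((1 + r)/2) powr (-\<tau>)) \<partial>lborel)"

lemma beta_int_pos: "beta_int s \<tau> > 0"
  unfolding beta_int_def
  by (rule nn_integral_lborel_pos[where A="{1..2}"]) (auto split: split_indicator)

lemma nn_integral_beta_int_scale:
  assumes "B > 0"
  shows "(\<integral>\<^sup>+r. indicator {0<..} r * ennreal (r powr s * ((B + r)/2) powr (-\<tau>)) \<partial>lborel)
    = beta_int s \<tau> * ennreal (B powr (s + 1 - \<tau>))"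
proof -
  let ?h = "\<lambda>r. indicator {0<..} r * ennreal (r powr s * ((1 + r)/2) powr (-\<tau>))"
  have "(\<integral>\<^sup>+r. indicator {0<..} r * ennreal (r powr s * ((B + r)/2) powr (-\<tau>)) \<partial>lborel)
    = ennreal B * (\<integral>\<^sup>+r. indicator {0<..} (0 + B * r) * ennreal ((0 + B * r) powr s * ((B + (0 + B * r))/2) powr (-\<tau>)) \<partial>lborel)"
    using assms by (subst nn_integral_real_affine[where c=B and t=0]) auto
  also have "(\<integral>\<^sup>+r. indicator {0<..} (0 + B * r) * ennreal ((0 + B * r) powr s * ((B + (0 + B * r))/2) powr (-\<tau>)) \<partial>lborel)
    = (\<integral>\<^sup>+r. ennreal (B powr (s - \<tau>)) * ?h r \<partial>lborel)"
  proof (intro nn_integral_cong)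
    fix r :: real
    have e: "(B + (0 + B * r))/2 = B * ((1+r)/2)" by (simp add: field_simps)
    show "indicator {0<..} (0 + B * r) * ennreal ((0 + B * r) powr s * ((B + (0 + B * r))/2) powr (-\<tau>))
      = ennreal (B powr (s - \<tau>)) * ?h r"
    proof (cases "r > 0")
      case True
      then have "(B * r) powr s * (B * ((1+r)/2)) powr (-\<tau>) = B powr (s - \<tau>) * (r powr s * ((1 + r)/2) powr (-\<tau>))"
        using assms by (simp only: powr_mult) (simp add: powr_diff powr_minus field_simps)
      then show ?thesis using True assms unfolding e by (simp add: ennreal_mult')
    qed (use assms in \<open>simp add: zero_less_mult_iff\<close>)
  qed
  also have "\<dots> = ennreal (B powr (s - \<tau>)) * beta_int s \<tau>"
    unfolding beta_int_def by (rule nn_integral_cmult) simp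
  also have "ennreal B * (ennreal (B powr (s - \<tau>)) * beta_int s \<tau>) = beta_int s \<tau> * ennreal (B powr (s + 1 - \<tau>))"
  proof -
    have "B powr (s + 1 - \<tau>) = B * B powr (s - \<tau>)"
      using assms by (simp add: powr_diff powr_add)
    then show ?thesis using assms by (simp add: ennreal_mult' mult_ac)
  qed
  finally show ?thesis .
qed

text \<open>Below 1 the integrand is comparable to \<open>r powr s\<close>, beyond 1 to
  \<open>r powr (s - \<tau>)\<close>; each hypothesis is the integrability of one of these
  powers.\<close>

lemma beta_int_finite:
  assumes "s > -1" "\<tau> > s + 1"
  shows "beta_int s \<tau> < \<infinity>"
proof -
  define M where "M = max 1 (2 powr \<tau>)"
  have M: "M \<ge> 0" unfolding M_def by simp
  let ?g = "\<lambda>r::real. indicator {0<..<1} r * ennreal (r powr s)"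
  let ?h = "\<lambda>r::real. indicator {1..} r * ennreal (r powr (s - \<tau>))"
  have "beta_int s \<tau> \<le> (\<integral>\<^sup>+r. ennreal M * ?g r + ennreal M * ?h r \<partial>lborel)"
    unfolding beta_int_def
  proof (intro nn_integral_mono)
    fix r :: real
    consider "r \<le> 0" | "0 < r" "r < 1" | "r \<ge> 1" by linarith
    then show "indicator {0<..} r * ennreal (r powr s * ((1 + r)/2) powr (-\<tau>)) \<le> ennreal M * ?g r + ennreal M * ?h r"
    proof cases
      case 2
      have "((1+r)/2) powr (-\<tau>) \<le> M * 1 powr (-\<tau>)" unfolding M_def by (rule powr_half_bounds) (use 2 in auto)
      then have "r powr s * ((1+r)/2) powr (-\<tau>) \<le> M * r powr s" using mult_right_mono[of "((1+r)/2) powr (-\<tau>)" M "r powr s"] by (simp add: mult.commute)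
      then show ?thesis using 2 M by (simp add: ennreal_leI flip: ennreal_mult')
    next
      case 3
      have "((1+r)/2) powr (-\<tau>) \<le> M * r powr (-\<tau>)" unfolding M_def by (rule powr_half_bounds) (use 3 in auto)
      then have "r powr s * ((1+r)/2) powr (-\<tau>) \<le> r powr s * (M * r powr (-\<tau>))" by (simp add: mult_left_mono)
      also have "\<dots> = M * r powr (s - \<tau>)" using 3 by (simp add: powr_diff powr_minus field_simps)
      finally show ?thesis using 3 M by (simp add: ennreal_leI flip: ennreal_mult')
    qed simp
  qed
  also have "\<dots> = ennreal M * (\<integral>\<^sup>+r. ?g r \<partial>lborel) + ennreal M * (\<integral>\<^sup>+r. ?h r \<partial>lborel)"
    by (simp add: nn_integral_add nn_integral_cmult)
  also have "\<dots> < \<infinity>"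
    using nn_integral_powr_from_0[of s] nn_integral_powr_to_inf[of "s - \<tau>"] assms
    by (simp add: ennreal_mult_less_top)
  finally show ?thesis .
qed

text \<open>If either condition fails, the integrand dominates a fixed multiple of
  \<open>1/r\<close> all the way to 0 or all the way to infinity, and \<open>1/r\<close> has
  infinite integral at both ends.\<close>

lemma beta_int_finiteD:
  assumes fin: "beta_int s \<tau> < \<infinity>"
  shows "s > -1" "\<tau> > s + 1"
proof -
  define c where "c = min 1 (2 powr \<tau>)"
  have c: "c > 0" "c \<ge> 0" unfolding c_def by auto
  have False if a: "\<And>K. \<exists>a b. 0 < a \<and> a \<le> b \<and> ln b - ln a \<ge> K \<and> (\<forall>r\<in>{a..b}. c * (1/r) \<le> r powr s * ((1 + r)/2) powr (-\<tau>))"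
  proof -
    \<comment> \<open>The requested logarithmic length makes \<open>c * (ln b - ln a)\<close> exceed
      the supposedly finite integral by at least 1.\<close>
    obtain a b where ab: "0 < a" "a \<le> b" "ln b - ln a \<ge> (enn2real (beta_int s \<tau>) + 1) / c"
       and *: "\<And>r. r \<in> {a..b} \<Longrightarrow> c * (1/r) \<le> r powr s * ((1 + r)/2) powr (-\<tau>)" using a by meson
    have "ennreal (enn2real (beta_int s \<tau>) + 1) \<le> ennreal (c * (ln b - ln a))"
      using ab c by (intro ennreal_leI) (simp add: field_simps)
    also have "\<dots> = (\<integral>\<^sup>+r. ennreal c * (ennreal (1/r) * indicator {a..b} r) \<partial>lborel)"
      using ab c by (simp add: nn_integral_cmult nn_integral_inverse_Icc ennreal_mult')
    also have "\<dots> \<le> beta_int s \<tau>" unfolding beta_int_def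
    proof (intro nn_integral_mono)
      fix r :: real
      show "ennreal c * (ennreal (1/r) * indicator {a..b} r) \<le> indicator {0<..} r * ennreal (r powr s * ((1 + r)/2) powr (-\<tau>))"
      proof (cases "r \<in> {a..b}")
        case True
        then show ?thesis using *[OF True] ab c by (simp add: ennreal_leI flip: ennreal_mult')
      qed simp
    qed
    also have "\<dots> = ennreal (enn2real (beta_int s \<tau>))" using fin by simp
    finally show False by (simp add: ennreal_le_iff)
  qed note contr = this
  show s: "s > -1"
  proof (rule ccontr)
    assume "\<not> s > -1"
    then have s: "s \<le> -1" by simp
    show False
    proof (rule contr)
      fix K :: real
      \<comment> \<open>The absolute value keeps the left endpoint at most 1 also for negative
        \<open>K\<close>; the logarithmic length of the interval is \<open>|K|\<close>.\<close>
      have "c * (1/r) \<le> r powr s * ((1 + r)/2) powr (-\<tau>)" if "r \<in> {exp (- \<bar>K\<bar>)..1}" for r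
      proof -
        have r: "0 < r" "r \<le> 1" using that exp_gt_zero[of "-\<bar>K\<bar>"] by (auto simp del: exp_gt_zero)
        have "c * 1 powr (-\<tau>) \<le> ((1+r)/2) powr (-\<tau>)" unfolding c_def by (rule powr_half_bounds) (use r in auto)
        moreover have "r powr (-1) \<le> r powr s" using powr_mono'[of s "-1" r] s r by auto
        ultimately have "r powr (-1) * c \<le> r powr s * ((1+r)/2) powr (-\<tau>)" using c by (intro mult_mono) auto
        then show ?thesis using r by (simp add: powr_minus field_simps)
      qed
      then show "\<exists>a b. 0 < a \<and> a \<le> b \<and> ln b - ln a \<ge> K \<and> (\<forall>r\<in>{a..b}. c * (1/r) \<le> r powr s * ((1 + r)/2) powr (-\<tau>))"
        by (intro exI[of _ "exp (- \<bar>K\<bar>)"] exI[of _ 1]) auto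
    qed
  qed
  show "\<tau> > s + 1"
  proof (rule ccontr)
    assume "\<not> \<tau> > s + 1"
    then have s: "s - \<tau> \<ge> -1" by simp
    show False
    proof (rule contr)
      fix K :: real
      have "c * (1/r) \<le> r powr s * ((1 + r)/2) powr (-\<tau>)" if "r \<in> {1..exp \<bar>K\<bar>}" for r
      proof -
        have r: "1 \<le> r" using that by auto
        have "c * r powr (-\<tau>) \<le> ((1+r)/2) powr (-\<tau>)" unfolding c_def by (rule powr_half_bounds) (use r in auto)
        then have "r powr s * (c * r powr (-\<tau>)) \<le> r powr s * ((1+r)/2) powr (-\<tau>)" by (intro mult_left_mono) auto
        moreover have "r powr (-1) \<le> r powr (s - \<tau>)" using powr_mono[of "-1" "s - \<tau>" r] s r by auto
        then have "c * r powr (-1) \<le> c * r powr (s - \<tau>)" using c by (intro mult_left_mono) auto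
        moreover have "c * r powr (s - \<tau>) = r powr s * (c * r powr (-\<tau>))" using r by (simp add: powr_diff powr_minus field_simps)
        ultimately have "c * r powr (-1) \<le> r powr s * ((1 + r)/2) powr (-\<tau>)" by linarith
        then show ?thesis using r by (simp add: powr_minus_divide)
      qed
      then show "\<exists>a b. 0 < a \<and> a \<le> b \<and> ln b - ln a \<ge> K \<and> (\<forall>r\<in>{a..b}. c * (1/r) \<le> r powr s * ((1 + r)/2) powr (-\<tau>))"
        by (intro exI[of _ 1] exI[of _ "exp \<bar>K\<bar>"]) auto
    qed
  qed
qed

section \<open>The Forelli-Rudin integral\<close>

text \<open>A box in the complex plane pulls back to a product of two intervals, and agreement on
  boxes determines Lebesgue measure.\<close>

lemma lborel_complex_eq_distr:
  "(lborel :: complex measure) = distr (lborel \<Otimes>\<^sub>M lborel) borel (\<lambda>(x, y). Complex x y)"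
proof (rule lborel_eqI)
  have [measurable]: "(\<lambda>(x, y). Complex x y) \<in> borel_measurable (lborel \<Otimes>\<^sub>M lborel)"
    by (simp add: Complex_eq split_beta')
  fix l u :: complex
  assume lu: "\<And>b. b \<in> Basis \<Longrightarrow> l \<bullet> b \<le> u \<bullet> b"
  have vim: "(\<lambda>(x, y). Complex x y) -` box l u \<inter> space (lborel \<Otimes>\<^sub>M lborel)
      = {Re l<..<Re u} \<times> {Im l<..<Im u}"
    by (auto simp: box_def Basis_complex_def space_pair_measure)
  have "Re l \<le> Re u" "Im l \<le> Im u" using lu[of 1] lu[of \<i>] by (auto simp: Basis_complex_def)
  then show "emeasure (distr (lborel \<Otimes>\<^sub>M lborel) borel (\<lambda>(x, y). Complex x y)) (box l u)
      = ennreal (\<Prod>b\<in>Basis. (u - l) \<bullet> b)"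
    by (simp add: emeasure_distr vim lborel.emeasure_pair_measure_Times Basis_complex_def ennreal_mult')
qed simp

text \<open>The real part is made the inner variable because the weight \<open>rho n u\<close>
  depends on imaginary parts only.\<close>

lemma nn_integral_lborel_complex:
  assumes [measurable]: "f \<in> borel_measurable (borel :: complex measure)"
  shows "(\<integral>\<^sup>+z. f z \<partial>lborel) = (\<integral>\<^sup>+y. \<integral>\<^sup>+x. f (Complex x y) \<partial>lborel \<partial>lborel)"
proof -
  have [measurable]: "(\<lambda>(x, y). Complex x y) \<in> borel_measurable (lborel \<Otimes>\<^sub>M lborel)"
    by (simp add: Complex_eq split_beta')
  have "(\<integral>\<^sup>+z. f z \<partial>lborel) = (\<integral>\<^sup>+p. f (Complex (fst p) (snd p)) \<partial>(lborel \<Otimes>\<^sub>M lborel))"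
    by (subst lborel_complex_eq_distr) (simp add: nn_integral_distr split_beta')
  also have "\<dots> = (\<integral>\<^sup>+y. \<integral>\<^sup>+x. f (Complex x y) \<partial>lborel \<partial>lborel)"
    by (subst lborel_pair.nn_integral_snd[symmetric]) (auto simp: Complex_eq)
  finally show ?thesis .
qed

text \<open>Two applications of the real formula, first in the real and then in the imaginary part
  of \<open>x\<close>; each lowers the exponent by \<open>1/2\<close>.\<close>

lemma nn_integral_complex_quadratic_powr:
  assumes "B > 0"
  shows "(\<integral>\<^sup>+x. ennreal (((cmod (z - x))\<^sup>2 / 4 + B) powr (-\<tau>)) \<partial>lborel)
    = quad_int \<tau> * quad_int (\<tau> - 1/2) * ennreal (B powr (1 - \<tau>))"
proof -
  have eq: "(cmod (z - Complex x y))\<^sup>2 / 4 + B = (Re z - x)\<^sup>2/4 + ((Im z - y)\<^sup>2/4 + B)" for x y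
    by (simp add: cmod_power2 field_simps)
  have "(\<integral>\<^sup>+x. ennreal (((cmod (z - x))\<^sup>2 / 4 + B) powr (-\<tau>)) \<partial>lborel)
     = (\<integral>\<^sup>+y. \<integral>\<^sup>+x. ennreal (((Re z - x)\<^sup>2/4 + ((Im z - y)\<^sup>2/4 + B)) powr (-\<tau>)) \<partial>lborel \<partial>lborel)"
    by (subst nn_integral_lborel_complex) (simp_all only: eq, measurable)
  also have "\<dots> = (\<integral>\<^sup>+y. quad_int \<tau> * ennreal (((Im z - y)\<^sup>2/4 + B) powr (-(\<tau> - 1/2))) \<partial>lborel)"
    using assms by (subst nn_integral_quadratic_powr) (auto intro!: add_nonneg_pos)
  also have "\<dots> = quad_int \<tau> * (quad_int (\<tau> - 1/2) * ennreal (B powr (1/2 - (\<tau> - 1/2))))"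
    using assms by (subst nn_integral_cmult) (auto simp only: nn_integral_quadratic_powr, measurable)
  finally show ?thesis by (simp add: mult_ac)
qed

text \<open>The constant produced by \<open>m\<close> successive complex integrations, each of which
  lowers the exponent by 1.\<close>

fun iter_quad_int :: "nat \<Rightarrow> real \<Rightarrow> ennreal" where
  "iter_quad_int 0 \<tau> = 1"
| "iter_quad_int (Suc m) \<tau> = quad_int \<tau> * quad_int (\<tau> - 1/2) * iter_quad_int m (\<tau> - 1)"

lemma iter_quad_int_pos: "iter_quad_int m \<tau> > 0"
  by (induction m arbitrary: \<tau>) (auto simp: ennreal_zero_less_mult_iff quad_int_pos)

text \<open>The arguments of \<open>quad_int\<close> descend in steps of \<open>1/2\<close> from
  \<open>\<tau>\<close> to \<open>\<tau> - m + 1/2\<close>, so all of them exceed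
  \<open>1/2\<close>.\<close>

lemma iter_quad_int_finite: "\<tau> > real m \<Longrightarrow> iter_quad_int m \<tau> < \<infinity>"
  by (induction m arbitrary: \<tau>) (auto simp: ennreal_mult_less_top quad_int_finite[simplified])

interpretation PC: product_sigma_finite "\<lambda>_::nat. lborel :: complex measure"
  by standard

text \<open>Coordinates are integrated one at a time: the remaining sum plus \<open>h\<close> is
  positive and serves as the \<open>B\<close> of
  \<open>nn_integral_complex_quadratic_powr\<close>.\<close>

lemma nn_integral_PiM_quadratic_powr:
  assumes "h > 0"
  shows "(\<integral>\<^sup>+x. ennreal (((\<Sum>j<m. (cmod (z j - x j))\<^sup>2) / 4 + h) powr (-\<tau>)) \<partial>PiM {..<m} (\<lambda>_. lborel))
    = iter_quad_int m \<tau> * ennreal (h powr (real m - \<tau>))"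
proof (induction m arbitrary: \<tau>)
  case 0
  then show ?case by (simp add: PiM_empty)
next
  case (Suc m)
  have "(\<integral>\<^sup>+x. ennreal (((\<Sum>j<Suc m. (cmod (z j - x j))\<^sup>2) / 4 + h) powr (-\<tau>)) \<partial>PiM {..<Suc m} (\<lambda>_. lborel))
    = (\<integral>\<^sup>+x. \<integral>\<^sup>+y. ennreal ((((cmod (z m - y))\<^sup>2 / 4 + ((\<Sum>j<m. (cmod (z j - x j))\<^sup>2) / 4 + h)) powr (-\<tau>))) \<partial>lborel \<partial>PiM {..<m} (\<lambda>_. lborel))"
    unfolding lessThan_Suc
    by (subst PC.product_nn_integral_insert)
       (auto intro!: nn_integral_cong simp: add_divide_distrib add_ac sum_divide_distrib)
  also have "\<dots> = (\<integral>\<^sup>+x. quad_int \<tau> * quad_int (\<tau> - 1/2) * ennreal (((\<Sum>j<m. (cmod (z j - x j))\<^sup>2) / 4 + h) powr (-(\<tau> - 1))) \<partial>PiM {..<m} (\<lambda>_. lborel))"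
    using assms by (intro nn_integral_cong, subst nn_integral_complex_quadratic_powr) (auto intro!: add_nonneg_pos divide_nonneg_pos sum_nonneg)
  also have "\<dots> = quad_int \<tau> * quad_int (\<tau> - 1/2) * (iter_quad_int m (\<tau> - 1) * ennreal (h powr (real m - (\<tau> - 1))))"
    by (subst nn_integral_cmult) (auto simp only: Suc.IH, measurable)
  finally show ?case by (simp add: mult_ac algebra_simps)
qed

section \<open>The domain, its measurability, and the real and imaginary parts of
  \<open>rho2\<close>\<close>

lemma rho_measurable [measurable]: "n \<ge> 1 \<Longrightarrow> rho n \<in> borel_measurable (Cn n)"
  unfolding rho_def[abs_def] Cn_def by (measurable; simp)

lemma cnj_measurable [measurable]: "cnj \<in> borel_measurable borel"
  by (intro borel_measurable_continuous_onI continuous_intros)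

lemma rho2_measurable [measurable]: "n \<ge> 1 \<Longrightarrow> rho2 n z \<in> borel_measurable (Cn n)"
  unfolding rho2_def[abs_def] Cn_def by (measurable; simp)

lemma TB_sets [measurable]: "n \<ge> 1 \<Longrightarrow> TB n \<in> sets (Cn n)"
  unfolding TB_def by measurable

lemma space_VB: "space (VB n) = TB n"
  unfolding VB_def by (auto simp: space_restrict_space TB_def)

lemma rho_measurable_VB [measurable]: "n \<ge> 1 \<Longrightarrow> rho n \<in> borel_measurable (VB n)"
  unfolding VB_def by (intro measurable_restrict_space1) measurable

lemma rho2_measurable_VB [measurable]: "n \<ge> 1 \<Longrightarrow> rho2 n z \<in> borel_measurable (VB n)"
  unfolding VB_def by (intro measurable_restrict_space1) measurable

lemma sigma_finite_VB: "n \<ge> 1 \<Longrightarrow> sigma_finite_measure (VB n)"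
proof -
  interpret I: finite_product_sigma_finite "\<lambda>_::nat. lborel :: complex measure" "{..<n}" by standard auto
  assume "n \<ge> 1"
  then show ?thesis unfolding VB_def Cn_def
    by (intro sigma_finite_measure_restrict_space I.sigma_finite_measure_axioms) (auto simp flip: Cn_def)
qed

text \<open>In each coordinate the parallelogram identity trades the square of
  \<open>Im z + Im u\<close> for that of \<open>Im z - Im u\<close>; the latter completes the
  squared modulus, and the remaining squares combine with the last coordinate to
  \<open>rho\<close>.\<close>

lemma Re_rho2:
  "Re (rho2 n z u) = (\<Sum>j<n-1. (cmod (z j - u j))\<^sup>2) / 4 + (rho n z + rho n u) / 2"
proof -
  have "Re (rho2 n z u) = ((\<Sum>j<n-1. (Re (z j) - Re (u j))\<^sup>2 - (Im (z j) + Im (u j))\<^sup>2) + 2 * (Im (z (n-1)) + Im (u (n-1)))) / 4"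
    by (simp add: rho2_def power2_eq_square)
  also have "(\<Sum>j<n-1. (Re (z j) - Re (u j))\<^sup>2 - (Im (z j) + Im (u j))\<^sup>2)
     = (\<Sum>j<n-1. (cmod (z j - u j))\<^sup>2 - 2 * (Im (z j))\<^sup>2 - 2 * (Im (u j))\<^sup>2)"
    by (intro sum.cong refl, unfold cmod_power2) (simp add: power2_eq_square algebra_simps)
  finally show ?thesis
    unfolding rho_def sum_subtractf sum_distrib_left[symmetric] by (simp add: field_simps)
qed

lemma Im_rho2:
  "Im (rho2 n z u) = (\<Sum>j<n-1. (Re (z j) - Re (u j)) * (Im (z j) + Im (u j))) / 2 - (Re (z (n-1)) - Re (u (n-1))) / 2"
proof -
  have "Im (rho2 n z u) = ((\<Sum>j<n-1. 2 * ((Re (z j) - Re (u j)) * (Im (z j) + Im (u j)))) - 2 * (Re (z (n-1)) - Re (u (n-1)))) / 4"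
    by (simp add: rho2_def power2_eq_square mult_ac)
  then show ?thesis unfolding sum_distrib_left[symmetric] by (simp add: field_simps)
qed

lemma Re_rho2_pos: "z \<in> TB n \<Longrightarrow> u \<in> TB n \<Longrightarrow> Re (rho2 n z u) > 0"
  unfolding Re_rho2 TB_def by (auto intro!: add_nonneg_pos sum_nonneg divide_nonneg_pos)

text \<open>The factors come from three integrations: over the real part of the last coordinate,
  where writing the modulus through its square halves the exponent; over the other coordinates,
  starting from exponent \<open>t - 1\<close>; and over \<open>r = rho n u\<close>, where the
  exponent \<open>t - n\<close> is left.\<close>

definition FR_const :: "nat \<Rightarrow> real \<Rightarrow> real \<Rightarrow> ennreal" where
  "FR_const n s t = quad_int (t/2) * iter_quad_int (n-1) (t-1) * beta_int s (t - real n)"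

text \<open>The identity is one between extended reals, so divergence of the integral is recorded as
  an infinite constant, independently of \<open>z\<close>.\<close>

lemma Forelli_Rudin:
  assumes n: "n \<ge> 1" and z: "z \<in> TB n"
  shows "(\<integral>\<^sup>+u. ennreal (rho n u powr s * cmod (rho2 n z u) powr (-t)) \<partial>VB n)
    = FR_const n s t * ennreal (rho n z powr (real n + 1 + s - t))"
proof -
  obtain m where m: "n = Suc m" using n by (cases n) auto
  let ?P = "PiM {..<m} (\<lambda>_. lborel) :: (nat \<Rightarrow> complex) measure"
  define R where "R = rho n z"
  have R: "R > 0" using z by (simp add: R_def TB_def)
  define q where "q x = (\<Sum>j<m. (Im (x j))\<^sup>2)" for x :: "nat \<Rightarrow> complex"
  define D where "D x = (\<Sum>j<m. (cmod (z j - x j))\<^sup>2)" for x :: "nat \<Rightarrow> complex"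
  \<comment> \<open>\<open>L x\<close> is the real part of the last coordinate of \<open>u\<close>
    at which the imaginary part of \<open>rho2 n z u\<close> vanishes.\<close>
  define L where "L x = Re (z m) - (\<Sum>j<m. (Re (z j) - Re (x j)) * (Im (z j) + Im (x j)))" for x :: "nat \<Rightarrow> complex"
  have [measurable]: "q \<in> borel_measurable ?P" "D \<in> borel_measurable ?P" "L \<in> borel_measurable ?P"
    unfolding q_def[abs_def] D_def[abs_def] L_def[abs_def] by measurable
  have D0: "D x \<ge> 0" for x unfolding D_def by (auto intro: sum_nonneg)
  define A where "A x r = D x / 4 + (R + r) / 2" for x r
  have Apos: "A x r > 0" if "r > 0" for x r
    unfolding A_def using D0[of x] R that by (intro add_nonneg_pos) auto
  \<comment> \<open>Extension by zero to the whole space, whose product structure allows the last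
    coordinate to be split off.\<close>
  define F where "F u = ennreal (rho n u powr s * cmod (rho2 n z u) powr (-t)) * indicator (TB n) u" for u
  have F_meas [measurable]: "F \<in> borel_measurable (Cn n)" unfolding F_def[abs_def] using n by measurable
  have rho_upd: "rho n (x(m := \<zeta>)) = Im \<zeta> - q x" for x \<zeta>
    by (simp add: rho_def q_def m)
  have norm_upd: "cmod (rho2 n z (x(m := \<zeta>))) powr (-t) = ((L x - Re \<zeta>)\<^sup>2/4 + (A x (Im \<zeta> - q x))\<^sup>2) powr (-(t/2))" for x \<zeta>
  proof -
    have 1: "Re (rho2 n z (x(m := \<zeta>))) = A x (Im \<zeta> - q x)"
      unfolding Re_rho2 rho_upd A_def D_def R_def by (simp add: m)
    have 2: "(Im (rho2 n z (x(m := \<zeta>))))\<^sup>2 = (L x - Re \<zeta>)\<^sup>2/4"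
      unfolding Im_rho2 L_def m by (simp add: power2_eq_square field_simps)
    have "cmod (rho2 n z (x(m := \<zeta>))) = ((L x - Re \<zeta>)\<^sup>2/4 + (A x (Im \<zeta> - q x))\<^sup>2) powr (1/2)"
      unfolding cmod_def 1 2 by (simp add: powr_half_sqrt add.commute)
    then show ?thesis by (simp add: powr_powr)
  qed
  have F_upd: "F (x(m := Complex a v)) = indicator {0<..} (v - q x) * ennreal ((v - q x) powr s) *
      ennreal (((L x - a)\<^sup>2/4 + (A x (v - q x))\<^sup>2) powr (-(t/2)))" if "x \<in> space ?P" for x a v
  proof -
    have "x(m := Complex a v) \<in> space (Cn n)" using that by (auto simp: Cn_def m space_PiM PiE_iff extensional_def)
    then show ?thesis
      unfolding F_def norm_upd rho_upd TB_def by (auto simp: ennreal_mult' rho_upd split: split_indicator)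
  qed
  have "(\<integral>\<^sup>+u. ennreal (rho n u powr s * cmod (rho2 n z u) powr (-t)) \<partial>VB n) = (\<integral>\<^sup>+u. F u \<partial>Cn n)"
    unfolding VB_def F_def using n by (subst nn_integral_restrict_space) auto
  also have "\<dots> = (\<integral>\<^sup>+x. \<integral>\<^sup>+\<zeta>. F (x(m := \<zeta>)) \<partial>lborel \<partial>?P)"
    using F_meas unfolding Cn_def m lessThan_Suc
    by (subst PC.product_nn_integral_insert) auto
  also have "\<dots> = (\<integral>\<^sup>+x. \<integral>\<^sup>+r. indicator {0<..} r * ennreal (r powr s) * quad_int (t/2) * ennreal (A x r powr (1 - t)) \<partial>lborel \<partial>?P)"
  proof (intro nn_integral_cong)
    fix x assume x: "x \<in> space ?P"
    have [measurable]: "(\<lambda>\<zeta>. F (x(m := \<zeta>))) \<in> borel_measurable borel"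
    proof -
      have "(\<lambda>\<zeta>. x(m := \<zeta>)) \<in> measurable borel (Cn n)"
        using x unfolding Cn_def m lessThan_Suc by (intro measurable_PiM_single') (auto simp: space_PiM PiE_iff extensional_def)
      then show ?thesis using F_meas by (rule measurable_compose)
    qed
    have "(\<integral>\<^sup>+\<zeta>. F (x(m := \<zeta>)) \<partial>lborel) = (\<integral>\<^sup>+v. \<integral>\<^sup>+a. F (x(m := Complex a v)) \<partial>lborel \<partial>lborel)"
      by (rule nn_integral_lborel_complex) measurable
    also have "\<dots> = (\<integral>\<^sup>+v. indicator {0<..} (v - q x) * ennreal ((v - q x) powr s) * quad_int (t/2) * ennreal (A x (v - q x) powr (1 - t)) \<partial>lborel)"
    proof (intro nn_integral_cong)
      fix v :: real
      show "(\<integral>\<^sup>+a. F (x(m := Complex a v)) \<partial>lborel) = indicator {0<..} (v - q x) * ennreal ((v - q x) powr s) * quad_int (t/2) * ennreal (A x (v - q x) powr (1 - t))"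
      proof (cases "v - q x > 0")
        case True
        have "((A x (v - q x))\<^sup>2) powr (1/2 - t/2) = A x (v - q x) powr (1 - t)"
        proof -
          have "(A x (v - q x))\<^sup>2 = A x (v - q x) powr 2" using Apos[OF True, of x] by simp
          moreover have "2 * (1/2 - t/2) = 1 - t" by simp
          ultimately show ?thesis by (simp only: powr_powr)
        qed
        then show ?thesis
          using Apos[OF True, of x]
          by (simp add: F_upd[OF x] nn_integral_cmult nn_integral_quadratic_powr mult_ac)
      qed (simp add: F_upd[OF x])
    qed
    \<comment> \<open>The translation \<open>v = q x + r\<close> makes \<open>r = rho n u\<close> a
      variable whose range no longer depends on \<open>x\<close>.\<close>
    also have "\<dots> = (\<integral>\<^sup>+r. indicator {0<..} r * ennreal (r powr s) * quad_int (t/2) * ennreal (A x r powr (1 - t)) \<partial>lborel)"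
      unfolding A_def by (subst nn_integral_real_affine[where c=1 and t="q x"]) auto
    finally show "(\<integral>\<^sup>+\<zeta>. F (x(m := \<zeta>)) \<partial>lborel) = (\<integral>\<^sup>+r. indicator {0<..} r * ennreal (r powr s) * quad_int (t/2) * ennreal (A x r powr (1 - t)) \<partial>lborel)" .
  qed
  \<comment> \<open>With \<open>r\<close> decoupled from \<open>x\<close>, the order is exchanged:
    at fixed \<open>r\<close> the number \<open>(R + r)/2\<close> is the \<open>h\<close> of
    \<open>nn_integral_PiM_quadratic_powr\<close>.\<close>
  also have "\<dots> = (\<integral>\<^sup>+r. \<integral>\<^sup>+x. indicator {0<..} r * ennreal (r powr s) * quad_int (t/2) * ennreal (A x r powr (1 - t)) \<partial>?P \<partial>lborel)"
  proof -
    interpret I: finite_product_sigma_finite "\<lambda>_::nat. lborel :: complex measure" "{..<m}" by standard auto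
    interpret pair_sigma_finite ?P "lborel :: real measure"
      by (intro pair_sigma_finite.intro I.sigma_finite_measure_axioms lborel.sigma_finite_measure_axioms)
    show ?thesis unfolding A_def by (rule Fubini'[symmetric]) measurable
  qed
  also have "\<dots> = (\<integral>\<^sup>+r. quad_int (t/2) * iter_quad_int m (t - 1) * (indicator {0<..} r * ennreal (r powr s * ((R + r)/2) powr (- (t - real n)))) \<partial>lborel)"
  proof (intro nn_integral_cong)
    fix r :: real
    show "(\<integral>\<^sup>+x. indicator {0<..} r * ennreal (r powr s) * quad_int (t/2) * ennreal (A x r powr (1 - t)) \<partial>?P)
      = quad_int (t/2) * iter_quad_int m (t - 1) * (indicator {0<..} r * ennreal (r powr s * ((R + r)/2) powr (- (t - real n))))"
    proof (cases "r > 0")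
      case True
      have "(\<integral>\<^sup>+x. ennreal (A x r powr (1 - t)) \<partial>?P) = iter_quad_int m (t - 1) * ennreal (((R + r)/2) powr (real m - (t - 1)))"
        using nn_integral_PiM_quadratic_powr[of "(R + r)/2" m z "t - 1"] True R unfolding A_def D_def by simp
      also have "real m - (t - 1) = - (t - real n)" by (simp add: m)
      finally show ?thesis using True by (simp add: nn_integral_cmult ennreal_mult' mult_ac A_def)
    qed simp
  qed
  also have "\<dots> = FR_const n s t * ennreal (R powr (s + 1 - (t - real n)))"
    by (subst nn_integral_cmult, measurable, subst nn_integral_beta_int_scale[OF R]) (simp add: FR_const_def m mult_ac)
  finally show ?thesis by (simp add: R_def algebra_simps)
qed

lemma FR_const_pos: "FR_const n s t > 0"
  unfolding FR_const_def by (simp add: ennreal_zero_less_mult_iff quad_int_pos iter_quad_int_pos beta_int_pos)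

text \<open>The hypotheses force \<open>t > n\<close>, which makes the first two factors finite; the
  beta factor needs the two inequalities themselves.\<close>

lemma FR_const_finite:
  assumes "n \<ge> 1" "s > -1" "t > real n + 1 + s"
  shows "FR_const n s t < \<infinity>"
proof -
  have "quad_int (t/2) < \<infinity>" "iter_quad_int (n-1) (t-1) < \<infinity>" "beta_int s (t - real n) < \<infinity>"
    by (rule quad_int_finite iter_quad_int_finite beta_int_finite; use assms in \<open>simp add: of_nat_diff\<close>)+
  then show ?thesis unfolding FR_const_def by (simp add: ennreal_mult_less_top)
qed

text \<open>The other factors are positive, so a finite product forces a finite beta factor; a zero
  factor could have hidden its divergence, as \<open>0 * top = 0\<close>.\<close>

lemma FR_const_finiteD:
  assumes "FR_const n s t < \<infinity>"
  shows "s > -1" "t > real n + 1 + s"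
proof -
  have "beta_int s (t - real n) < \<infinity>"
    using assms quad_int_pos[of "t/2"] iter_quad_int_pos[of "n-1" "t-1"] beta_int_pos[of s "t - real n"]
    unfolding FR_const_def by (auto simp: ennreal_mult_less_top)
  from beta_int_finiteD[OF this] show "s > -1" "t > real n + 1 + s" by auto
qed

section \<open>Hoelder's inequality and its converse\<close>

lemma epow_ennreal: "x \<ge> 0 \<Longrightarrow> epow (ennreal x) r = ennreal (x powr r)"
  by (simp add: epow_def)

lemma epow_top [simp]: "epow top r = top"
  by (simp add: epow_def)

lemma epow_0 [simp]: "epow 0 r = 0"
  by (simp add: epow_def)

text \<open>The values \<open>epow 0 r = 0\<close> and \<open>epow top r = top\<close> are
  compatible with \<open>0 * top = 0\<close>, so multiplicativity holds for every real
  \<open>r\<close>.\<close>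

lemma epow_mult: "epow (x * y) r = epow x r * epow y r"
proof (cases x; cases y)
  fix a b assume *: "x = ennreal a" "0 \<le> a" "y = ennreal b" "0 \<le> b"
  have "epow (x * y) r = epow (ennreal (a * b)) r" using * by (simp add: ennreal_mult')
  also have "\<dots> = ennreal (a powr r * b powr r)" using * by (simp only: epow_ennreal mult_nonneg_nonneg powr_mult)
  also have "\<dots> = epow x r * epow y r" using * by (simp add: epow_ennreal ennreal_mult')
  finally show ?thesis .
next
  fix a assume *: "x = ennreal a" "0 \<le> a" "y = top"
  then show ?thesis by (cases "a = 0") (auto simp: ennreal_mult_top epow_ennreal)
next
  fix b assume *: "x = top" "y = ennreal b" "0 \<le> b"
  then show ?thesis by (cases "b = 0") (auto simp: ennreal_top_mult epow_ennreal)
qed simp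

lemma epow_epow: "epow (epow x r) s = epow x (r * s)"
  by (cases x) (auto simp: epow_ennreal powr_powr)

lemma epow_eq_0_iff: "epow x r = 0 \<longleftrightarrow> x = 0"
  by (cases x) (auto simp: epow_ennreal ennreal_eq_0_iff)

lemma epow_less_top_iff: "epow x r < top \<longleftrightarrow> x < top"
  by (cases x) (auto simp: epow_ennreal)

lemma epow_measurable [measurable]:
  assumes [measurable]: "f \<in> borel_measurable M"
  shows "(\<lambda>x. epow (f x) r) \<in> borel_measurable M"
  unfolding epow_def by measurable

lemma ennreal_Youngs_inequality:
  assumes "p > 1" "q > 1" "1/p + 1/q = 1"
  shows "x * y \<le> ennreal (1/p) * epow x p + ennreal (1/q) * epow y q"
proof (cases x; cases y)
  fix a b assume *: "x = ennreal a" "0 \<le> a" "y = ennreal b" "0 \<le> b"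
  have "a * b \<le> a powr p / p + b powr q / q"
    by (rule Youngs_inequality) (use * assms in auto)
  then have "ennreal (a * b) \<le> ennreal (1/p * a powr p + 1/q * b powr q)"
    by (intro ennreal_leI) simp
  also have "\<dots> = ennreal (1/p) * ennreal (a powr p) + ennreal (1/q) * ennreal (b powr q)"
    using assms by (subst ennreal_plus) (simp_all add: ennreal_mult'[symmetric])
  finally show ?thesis using * by (simp add: epow_ennreal ennreal_mult'[symmetric])
qed (use assms in \<open>auto simp: ennreal_mult_top ennreal_top_mult ennreal_mult_eq_top_iff\<close>)

text \<open>Both functions are scaled to norm 1 and Young's inequality is integrated; norms equal to
  0 or infinity cannot be normalised and are treated apart.\<close>

lemma nn_integral_Holder:
  assumes pq: "p > 1" "q > 1" "1/p + 1/q = 1"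
    and [measurable]: "f \<in> borel_measurable M" "g \<in> borel_measurable M"
  shows "(\<integral>\<^sup>+x. f x * g x \<partial>M)
    \<le> epow (\<integral>\<^sup>+x. epow (f x) p \<partial>M) (1/p) * epow (\<integral>\<^sup>+x. epow (g x) q \<partial>M) (1/q)"
proof -
  define a where "a = (\<integral>\<^sup>+x. epow (f x) p \<partial>M)"
  define b where "b = (\<integral>\<^sup>+x. epow (g x) q \<partial>M)"
  consider "a = 0" | "b = 0" | "a \<noteq> 0" "b \<noteq> 0" "a = top \<or> b = top" | "a \<noteq> 0" "b \<noteq> 0" "a < top" "b < top"
    by (metis top.not_eq_extremum)
  then have "(\<integral>\<^sup>+x. f x * g x \<partial>M) \<le> epow a (1/p) * epow b (1/q)"
  proof cases
    case 1
    then have "AE x in M. f x = 0" by (simp add: a_def nn_integral_0_iff_AE epow_eq_0_iff)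
    then have "(\<integral>\<^sup>+x. f x * g x \<partial>M) = (\<integral>\<^sup>+x. 0 \<partial>M)" by (intro nn_integral_cong_AE) auto
    then show ?thesis by simp
  next
    case 2
    then have "AE x in M. g x = 0" by (simp add: b_def nn_integral_0_iff_AE epow_eq_0_iff)
    then have "(\<integral>\<^sup>+x. f x * g x \<partial>M) = (\<integral>\<^sup>+x. 0 \<partial>M)" by (intro nn_integral_cong_AE) auto
    then show ?thesis by simp
  next
    case 3
    \<comment> \<open>Neither factor vanishes, so one infinite factor makes the right-hand side
      infinite.\<close>
    then have "epow a (1/p) * epow b (1/q) = top"
      by (auto simp: ennreal_mult_eq_top_iff epow_eq_0_iff)
    then show ?thesis by simp
  next
    case 4
    obtain a' where a': "a = ennreal a'" "a' > 0" using 4 by (cases a) (auto simp: ennreal_eq_0_iff)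
    obtain b' where b': "b = ennreal b'" "b' > 0" using 4 by (cases b) (auto simp: ennreal_eq_0_iff)
    \<comment> \<open>\<open>a\<close> is the integral of the p-th power, so this is the reciprocal
      of the norm of \<open>f\<close>; \<open>cb\<close> is the same for \<open>g\<close>.\<close>
    define ca where "ca = ennreal (a' powr (-1/p))"
    define cb where "cb = ennreal (b' powr (-1/q))"
    have ca: "epow ca p * a = 1" "epow a (1/p) * ca = 1"
    proof -
      have "(a' powr (-1/p)) powr p = a' powr (-1)" unfolding powr_powr using pq by simp
      then show "epow ca p * a = 1" unfolding ca_def a'(1) using a'(2)
        by (simp add: epow_ennreal ennreal_mult'[symmetric] powr_minus_divide)
      show "epow a (1/p) * ca = 1" unfolding ca_def a'(1) using a'(2)
        by (simp add: epow_ennreal ennreal_mult'[symmetric] powr_minus_divide)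
    qed
    have cb: "epow cb q * b = 1" "epow b (1/q) * cb = 1"
    proof -
      have "(b' powr (-1/q)) powr q = b' powr (-1)" unfolding powr_powr using pq by simp
      then show "epow cb q * b = 1" unfolding cb_def b'(1) using b'(2)
        by (simp add: epow_ennreal ennreal_mult'[symmetric] powr_minus_divide)
      show "epow b (1/q) * cb = 1" unfolding cb_def b'(1) using b'(2)
        by (simp add: epow_ennreal ennreal_mult'[symmetric] powr_minus_divide)
    qed
    have "(\<integral>\<^sup>+x. (ca * f x) * (cb * g x) \<partial>M) \<le> (\<integral>\<^sup>+x. ennreal (1/p) * epow (ca * f x) p + ennreal (1/q) * epow (cb * g x) q \<partial>M)"
      by (intro nn_integral_mono ennreal_Youngs_inequality pq)
    also have "\<dots> = ennreal (1/p) * (epow ca p * a) + ennreal (1/q) * (epow cb q * b)"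
      by (simp add: epow_mult nn_integral_add nn_integral_cmult a_def b_def)
    also have "\<dots> = 1" unfolding ca cb using pq by (simp add: ennreal_plus[symmetric] del: ennreal_plus)
    finally have le: "(\<integral>\<^sup>+x. (ca * f x) * (cb * g x) \<partial>M) \<le> 1" .
    have "(\<integral>\<^sup>+x. f x * g x \<partial>M) = (epow a (1/p) * ca) * (epow b (1/q) * cb) * (\<integral>\<^sup>+x. f x * g x \<partial>M)"
      unfolding ca cb by simp
    also have "\<dots> = epow a (1/p) * epow b (1/q) * (\<integral>\<^sup>+x. (ca * f x) * (cb * g x) \<partial>M)"
      by (simp add: nn_integral_cmult[symmetric] mult_ac)
    also have "\<dots> \<le> epow a (1/p) * epow b (1/q) * 1" by (intro mult_left_mono le) auto
    finally show ?thesis by simp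
  qed
  then show ?thesis by (simp add: a_def b_def)
qed

text \<open>Testing with \<open>\<phi> powr (q - 1)\<close> gives equality in Hoelder's inequality.
  Its norm might be infinite, so it is cut off to sets of finite measure on which
  \<open>\<phi>\<close> is bounded; these sets exhaust the space.\<close>

lemma nn_integral_converse_Holder:
  fixes \<phi> :: "'a \<Rightarrow> real"
  assumes "sigma_finite_measure M"
    and pq: "p > 1" "q > 1" "1/p + 1/q = 1" and C: "C \<ge> 0"
    and [measurable]: "\<phi> \<in> borel_measurable M" and \<phi>0: "\<And>x. \<phi> x \<ge> 0"
    and bnd: "\<And>g :: 'a \<Rightarrow> real. g \<in> borel_measurable M \<Longrightarrow> (\<And>x. g x \<ge> 0) \<Longrightarrow> (\<integral>\<^sup>+x. ennreal (g x powr p) \<partial>M) < \<infinity> \<Longrightarrow>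
        (\<integral>\<^sup>+x. ennreal (\<phi> x * g x) \<partial>M) \<le> ennreal C * epow (\<integral>\<^sup>+x. ennreal (g x powr p) \<partial>M) (1/p)"
  shows "(\<integral>\<^sup>+x. ennreal (\<phi> x powr q) \<partial>M) \<le> ennreal (C powr q)"
proof -
  interpret sigma_finite_measure M by fact
  obtain A :: "nat \<Rightarrow> 'a set" where A: "range A \<subseteq> sets M" "(\<Union>i. A i) = space M" "\<And>i. emeasure M (A i) \<noteq> \<infinity>" "incseq A"
    using sigma_finite_incseq by blast
  have [measurable]: "A k \<in> sets M" for k using A(1) by auto
  define E where "E k = {x\<in>A k. \<phi> x \<le> real k}" for k
  have E_eq: "E k = A k \<inter> {x\<in>space M. \<phi> x \<le> real k}" for k
    unfolding E_def using sets.sets_into_space[of "A k" M] by auto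
  have [measurable]: "E k \<in> sets M" for k unfolding E_eq by measurable
  let ?h = "\<lambda>k x. ennreal (\<phi> x powr q * indicator (E k) x)"
  \<comment> \<open>This makes the p-th power of the extremal function equal to its product with
    \<open>\<phi>\<close>, so both sides of the assumed bound involve the same integral
    \<open>j\<close>.\<close>
  have qp: "(q - 1) * p = q" using pq by (simp add: field_simps)
  have J: "(\<integral>\<^sup>+x. ?h k x \<partial>M) \<le> ennreal (C powr q)" for k
  proof -
    have "(\<integral>\<^sup>+x. ?h k x \<partial>M) \<le> (\<integral>\<^sup>+x. ennreal (real k powr q) * indicator (A k) x \<partial>M)"
      using pq \<phi>0 by (intro nn_integral_mono) (auto simp: E_def intro!: ennreal_leI powr_mono2 split: split_indicator)
    also have "\<dots> < \<infinity>" using A(3)[of k] by (simp add: nn_integral_cmult ennreal_mult_less_top less_top)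
    finally have fin: "(\<integral>\<^sup>+x. ?h k x \<partial>M) < \<infinity>" .
    define j where "j = enn2real (\<integral>\<^sup>+x. ?h k x \<partial>M)"
    have j: "(\<integral>\<^sup>+x. ?h k x \<partial>M) = ennreal j" "j \<ge> 0" using fin by (auto simp: j_def)
    \<comment> \<open>the extremal function in Hoelder's inequality, cut off to have finite norm\<close>
    define g where "g x = \<phi> x powr (q - 1) * indicator (E k) x" for x
    have [measurable]: "g \<in> borel_measurable M" unfolding g_def[abs_def] by measurable
    have gp: "g x powr p = \<phi> x powr q * indicator (E k) x" for x
      using qp pq by (auto simp: g_def powr_powr split: split_indicator)
    have gphi: "\<phi> x * g x = \<phi> x powr q * indicator (E k) x" for x
      using \<phi>0[of x] by (cases "\<phi> x = 0") (auto simp: g_def powr_diff field_simps)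
    have "(\<integral>\<^sup>+x. ennreal (\<phi> x * g x) \<partial>M) \<le> ennreal C * epow (\<integral>\<^sup>+x. ennreal (g x powr p) \<partial>M) (1/p)"
      by (rule bnd) (use fin gp in \<open>auto simp: g_def\<close>)
    then have "ennreal j \<le> ennreal (C * j powr (1/p))"
      unfolding gp gphi j(1) using C j by (simp add: epow_ennreal ennreal_mult')
    then have jle: "j \<le> C * j powr (1/p)" using C by (simp add: ennreal_le_iff)
    \<comment> \<open>Division by \<open>j powr (1/p)\<close> is possible because the cut-off made
      \<open>j\<close> finite; the exponent \<open>1 - 1/p = 1/q\<close> remains.\<close>
    have "j \<le> C powr q"
    proof (cases "j = 0")
      case False
      then have j0: "j > 0" using j by simp
      have "j powr (1/q) * j powr (1/p) = j" using j0 pq by (simp add: powr_add[symmetric] add.commute)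
      then have "j powr (1/q) * j powr (1/p) \<le> C * j powr (1/p)" using jle by simp
      then have "j powr (1/q) \<le> C" using j0 by simp
      then have "(j powr (1/q)) powr q \<le> C powr q" using pq by (intro powr_mono2) auto
      then show ?thesis using j0 pq by (simp add: powr_powr)
    qed simp
    then show ?thesis unfolding j(1) by (rule ennreal_leI)
  qed
  have "(\<integral>\<^sup>+x. ennreal (\<phi> x powr q) \<partial>M) \<le> (\<integral>\<^sup>+x. (SUP k. ?h k x) \<partial>M)"
  proof (intro nn_integral_mono)
    fix x assume "x \<in> space M"
    then obtain i where i: "x \<in> A i" using A(2) by auto
    obtain l where l: "\<phi> x \<le> real l" using real_arch_simple by blast
    have "x \<in> E (max i l)"
      using i l incseqD[OF A(4), of i "max i l"] by (auto simp: E_def)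
    then have "ennreal (\<phi> x powr q) = ?h (max i l) x" by simp
    also have "\<dots> \<le> (SUP k. ?h k x)" by (rule SUP_upper) simp
    finally show "ennreal (\<phi> x powr q) \<le> (SUP k. ?h k x)" .
  qed
  also have "\<dots> = (SUP k. \<integral>\<^sup>+x. ?h k x \<partial>M)"
  proof (rule nn_integral_monotone_convergence_SUP)
    show "incseq ?h"
    proof (rule incseq_SucI, rule le_funI)
      fix k x
      have "E k \<subseteq> E (Suc k)" using incseqD[OF A(4), of k "Suc k"] by (auto simp: E_def)
      then show "?h k x \<le> ?h (Suc k) x" by (auto intro!: ennreal_leI split: split_indicator)
    qed
  qed measurable
  also have "\<dots> \<le> ennreal (C powr q)" by (intro SUP_least J)
  finally show ?thesis .
qed

section \<open>Sufficiency\<close>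

text \<open>In each variable the weight is shared: \<open>rho powr (al/p)\<close> goes to
  \<open>f\<close> and its inverse to the kernel. Hoelder's inequality is applied in the first
  variable with the second fixed, then in the second, following the order of integration in
  \<open>mixed_norm\<close>.\<close>

lemma mixed_Holder:
  fixes f :: "(nat \<Rightarrow> complex) \<times> (nat \<Rightarrow> complex) \<Rightarrow> complex"
  assumes n: "n \<ge> 1"
    and pq1: "p1 > 1" "q1 > 1" "1/p1 + 1/q1 = 1" and pq2: "p2 > 1" "q2 > 1" "1/p2 + 1/q2 = 1"
    and f [measurable]: "f \<in> borel_measurable (VB2 n)"
    and k [measurable]: "k1 \<in> borel_measurable (VB n)" "k2 \<in> borel_measurable (VB n)"
    and k0: "\<And>u. k1 u \<ge> 0" "\<And>u. k2 u \<ge> 0"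
  shows "(\<integral>\<^sup>+ue. ennreal (k1 (fst ue) * k2 (snd ue) * norm (f ue)) \<partial>VB2 n)
    \<le> epow (\<integral>\<^sup>+u. ennreal ((k1 u * rho n u powr (-al1/p1)) powr q1) \<partial>VB n) (1/q1)
      * epow (\<integral>\<^sup>+u. ennreal ((k2 u * rho n u powr (-al2/p2)) powr q2) \<partial>VB n) (1/q2)
      * mixed_norm n p1 p2 al1 al2 f"
proof -
  interpret V: sigma_finite_measure "VB n" by (rule sigma_finite_VB[OF n])
  interpret pair_sigma_finite "VB n" "VB n" by standard
  have f' [measurable]: "f \<in> borel_measurable (VB n \<Otimes>\<^sub>M VB n)" using f by (simp add: VB2_def)
  note [measurable] = rho_measurable_VB[OF n]
  have rpos: "rho n u > 0" if "u \<in> space (VB n)" for u using that by (simp add: space_VB TB_def)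
  define N1 where "N1 = epow (\<integral>\<^sup>+u. ennreal ((k1 u * rho n u powr (-al1/p1)) powr q1) \<partial>VB n) (1/q1)"
  define N2 where "N2 = epow (\<integral>\<^sup>+u. ennreal ((k2 u * rho n u powr (-al2/p2)) powr q2) \<partial>VB n) (1/q2)"
  define X where "X w = (\<integral>\<^sup>+ z. ennreal (norm (f (z, w)) powr p1 * rho n z powr al1) \<partial>VB n)" for w
  have [measurable]: "X \<in> borel_measurable (VB n)"
    unfolding X_def[abs_def] by measurable
  have inner: "(\<integral>\<^sup>+u. ennreal (k1 u * norm (f (u, e))) \<partial>VB n) \<le> epow (X e) (1/p1) * N1" if e: "e \<in> space (VB n)" for e
  proof -
    have [measurable]: "(\<lambda>u. f (u, e)) \<in> borel_measurable (VB n)" using e by measurable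
    have "(\<integral>\<^sup>+u. ennreal (k1 u * norm (f (u, e))) \<partial>VB n) =
      (\<integral>\<^sup>+u. ennreal (norm (f (u, e)) * rho n u powr (al1/p1)) * ennreal (k1 u * rho n u powr (-al1/p1)) \<partial>VB n)"
      using k0 by (intro nn_integral_cong) (auto dest: rpos simp: ennreal_mult'[symmetric] powr_minus field_simps)
    also have "\<dots> \<le> epow (\<integral>\<^sup>+u. epow (ennreal (norm (f (u, e)) * rho n u powr (al1/p1))) p1 \<partial>VB n) (1/p1)
       * epow (\<integral>\<^sup>+u. epow (ennreal (k1 u * rho n u powr (-al1/p1))) q1 \<partial>VB n) (1/q1)"
      by (rule nn_integral_Holder[OF pq1]) measurable
    also have "(\<integral>\<^sup>+u. epow (ennreal (norm (f (u, e)) * rho n u powr (al1/p1))) p1 \<partial>VB n) = X e"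
      unfolding X_def using pq1 by (intro nn_integral_cong) (simp add: epow_ennreal powr_mult powr_powr)
    also have "(\<integral>\<^sup>+u. epow (ennreal (k1 u * rho n u powr (-al1/p1))) q1 \<partial>VB n) = (\<integral>\<^sup>+u. ennreal ((k1 u * rho n u powr (-al1/p1)) powr q1) \<partial>VB n)"
      using k0 by (intro nn_integral_cong) (simp add: epow_ennreal)
    finally show ?thesis by (simp add: N1_def)
  qed
  have "(\<integral>\<^sup>+ue. ennreal (k1 (fst ue) * k2 (snd ue) * norm (f ue)) \<partial>VB2 n)
      = (\<integral>\<^sup>+e. \<integral>\<^sup>+u. ennreal (k1 u * k2 e * norm (f (u, e))) \<partial>VB n \<partial>VB n)"
    unfolding VB2_def by (subst nn_integral_snd[symmetric]) simp_all
  also have "\<dots> = (\<integral>\<^sup>+e. ennreal (k2 e) * (\<integral>\<^sup>+u. ennreal (k1 u * norm (f (u, e))) \<partial>VB n) \<partial>VB n)"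
  proof (intro nn_integral_cong)
    fix e assume e: "e \<in> space (VB n)"
    have [measurable]: "(\<lambda>u. f (u, e)) \<in> borel_measurable (VB n)" using e by measurable
    show "(\<integral>\<^sup>+u. ennreal (k1 u * k2 e * norm (f (u, e))) \<partial>VB n) = ennreal (k2 e) * (\<integral>\<^sup>+u. ennreal (k1 u * norm (f (u, e))) \<partial>VB n)"
      using k0 by (subst nn_integral_cmult[symmetric]) (auto simp: ennreal_mult'[symmetric] mult_ac)
  qed
  also have "\<dots> \<le> (\<integral>\<^sup>+e. ennreal (k2 e) * (epow (X e) (1/p1) * N1) \<partial>VB n)"
    by (intro nn_integral_mono mult_left_mono inner) auto
  also have "\<dots> = (\<integral>\<^sup>+e. N1 * ((epow (X e) (1/p1) * ennreal (rho n e powr (al2/p2))) * ennreal (k2 e * rho n e powr (-al2/p2))) \<partial>VB n)"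
  proof (intro nn_integral_cong)
    fix e assume e: "e \<in> space (VB n)"
    have "ennreal (k2 e) = ennreal (rho n e powr (al2/p2)) * ennreal (k2 e * rho n e powr (-al2/p2))"
      using k0 rpos[OF e] by (simp add: ennreal_mult'[symmetric] powr_minus field_simps)
    then show "ennreal (k2 e) * (epow (X e) (1/p1) * N1) = N1 * ((epow (X e) (1/p1) * ennreal (rho n e powr (al2/p2))) * ennreal (k2 e * rho n e powr (-al2/p2)))"
      by (simp add: mult_ac)
  qed
  also have "\<dots> = N1 * (\<integral>\<^sup>+e. (epow (X e) (1/p1) * ennreal (rho n e powr (al2/p2))) * ennreal (k2 e * rho n e powr (-al2/p2)) \<partial>VB n)"
    by (rule nn_integral_cmult) measurable
  also have "\<dots> \<le> N1 * (epow (\<integral>\<^sup>+e. epow (epow (X e) (1/p1) * ennreal (rho n e powr (al2/p2))) p2 \<partial>VB n) (1/p2)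
      * epow (\<integral>\<^sup>+e. epow (ennreal (k2 e * rho n e powr (-al2/p2))) q2 \<partial>VB n) (1/q2))"
    by (intro mult_left_mono nn_integral_Holder[OF pq2]) auto
  also have "(\<integral>\<^sup>+e. epow (ennreal (k2 e * rho n e powr (-al2/p2))) q2 \<partial>VB n) = (\<integral>\<^sup>+u. ennreal ((k2 u * rho n u powr (-al2/p2)) powr q2) \<partial>VB n)"
    using k0 by (intro nn_integral_cong) (simp add: epow_ennreal)
  also have "epow (\<integral>\<^sup>+e. epow (epow (X e) (1/p1) * ennreal (rho n e powr (al2/p2))) p2 \<partial>VB n) (1/p2) = mixed_norm n p1 p2 al1 al2 f"
    unfolding mixed_norm_def X_def[symmetric] using pq2
    by (intro arg_cong2[where f=epow] nn_integral_cong refl) (simp add: epow_mult epow_epow epow_ennreal powr_powr)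
  finally show ?thesis unfolding N1_def[symmetric] N2_def[symmetric] by (simp add: mult_ac)
qed

section \<open>One-variable kernel factors and their dual norms\<close>

definition ker1 :: "nat \<Rightarrow> real \<Rightarrow> real \<Rightarrow> real \<Rightarrow> (nat \<Rightarrow> complex) \<Rightarrow> (nat \<Rightarrow> complex) \<Rightarrow> real" where
  "ker1 n a b c z u = rho n z powr a * rho n u powr b * cmod (rho2 n z u) powr (-c)"

lemma ker1_nonneg: "ker1 n a b c z u \<ge> 0"
  by (simp add: ker1_def)

lemma ker1_measurable [measurable]: "n \<ge> 1 \<Longrightarrow> ker1 n a b c z \<in> borel_measurable (VB n)"
  unfolding ker1_def[abs_def] by measurable

text \<open>Expanding the q-th power leaves a Forelli-Rudin integral with
  \<open>s = (b - al/p) * q\<close> and \<open>t = c * q\<close>.\<close>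

lemma ker1_Lq:
  assumes n: "n \<ge> 1" and pq: "p > 1" "q > 1" "1/p + 1/q = 1" and z: "z \<in> TB n"
  shows "(\<integral>\<^sup>+u. ennreal ((ker1 n a b c z u * rho n u powr (-al/p)) powr q) \<partial>VB n)
    = FR_const n ((b - al/p) * q) (c * q) * ennreal (rho n z powr (a * q + real n + 1 + (b - al/p) * q - c * q))"
proof -
  have zp: "rho n z > 0" using z by (simp add: TB_def)
  have "(\<integral>\<^sup>+u. ennreal ((ker1 n a b c z u * rho n u powr (-al/p)) powr q) \<partial>VB n)
     = (\<integral>\<^sup>+u. ennreal (rho n z powr (a * q)) * ennreal (rho n u powr ((b - al/p) * q) * cmod (rho2 n z u) powr (-(c * q))) \<partial>VB n)"
  proof (intro nn_integral_cong)
    fix u assume "u \<in> space (VB n)"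
    then have u: "rho n u > 0" by (simp add: space_VB TB_def)
    have "ker1 n a b c z u * rho n u powr (-al/p) = rho n z powr a * (rho n u powr (b - al/p) * cmod (rho2 n z u) powr (-c))"
      using u by (simp add: ker1_def powr_diff powr_minus field_simps)
    then show "ennreal ((ker1 n a b c z u * rho n u powr (-al/p)) powr q)
      = ennreal (rho n z powr (a * q)) * ennreal (rho n u powr ((b - al/p) * q) * cmod (rho2 n z u) powr (-(c * q)))"
      by (simp add: powr_mult powr_powr ennreal_mult'[symmetric])
  qed
  also have "\<dots> = ennreal (rho n z powr (a * q)) * (FR_const n ((b - al/p) * q) (c * q) * ennreal (rho n z powr (real n + 1 + (b - al/p) * q - c * q)))"
    using n by (subst nn_integral_cmult) (auto simp: Forelli_Rudin[OF n z])
  also have "\<dots> = FR_const n ((b - al/p) * q) (c * q) * ennreal (rho n z powr (a * q + real n + 1 + (b - al/p) * q - c * q))"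
  proof -
    have "rho n z powr (a * q + real n + 1 + (b - al/p) * q - c * q) = rho n z powr (a * q) * rho n z powr (real n + 1 + (b - al/p) * q - c * q)"
      by (simp add: powr_add[symmetric] algebra_simps)
    then show ?thesis by (simp add: ennreal_mult' mult_ac)
  qed
  finally show ?thesis .
qed

text \<open>The left side expresses that the dual norm in \<open>ker1_Lq\<close> is finite and
  independent of \<open>z\<close>. Since \<open>q * (1 - 1/p) = 1\<close>, its equation is
  \<open>q\<close> times the formula for \<open>c\<close>; given that equation, the gap in the last
  inequality is \<open>a * q\<close>.\<close>

lemma exponent_conditions:
  fixes a b c al p q N :: real
  assumes pq: "p > 1" "q > 1" "1/p + 1/q = 1"
  shows "(a * q + N + 1 + (b - al/p) * q - c * q = 0 \<and> (b - al/p) * q > -1 \<and> c * q > N + 1 + (b - al/p) * q)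
    \<longleftrightarrow> a > 0 \<and> al + 1 < p * (b + 1) \<and> c = N + 1 + a + b - (N + 1 + al) / p"
proof -
  have q: "q = p / (p - 1)" using pq by (simp add: field_simps)
  have p1: "p - 1 > 0" using pq by simp
  have 1: "a * q + N + 1 + (b - al/p) * q - c * q = q * (N + 1 + a + b - (N + 1 + al) / p - c)"
  proof -
    have "1 - 1/p = 1/q" using pq by linarith
    then have h: "q * (1 - 1/p) = 1" using pq(2) by (simp only:) simp
    have "q * (N + 1 + a + b - (N + 1 + al) / p - c) = q * (a + b - al/p - c) + (N + 1) * (q * (1 - 1/p))"
      by (simp add: algebra_simps add_divide_distrib)
    then show ?thesis unfolding h by (simp add: algebra_simps)
  qed
  have 2: "(b - al/p) * q > -1 \<longleftrightarrow> al + 1 < p * (b + 1)"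
  proof -
    have "(b - al/p) * q = (p * b - al) / (p - 1)" unfolding q using pq p1 by (simp add: field_simps)
    then show ?thesis using p1 by (simp only: pos_less_divide_eq) (auto simp: algebra_simps)
  qed
  have 3: "c * q > N + 1 + (b - al/p) * q \<longleftrightarrow> a > 0" if "a * q + N + 1 + (b - al/p) * q - c * q = 0"
  proof -
    have "c * q - (N + 1 + (b - al/p) * q) = a * q" using that by simp
    moreover have "a * q > 0 \<longleftrightarrow> a > 0" using pq by (simp add: zero_less_mult_iff)
    ultimately show ?thesis by linarith
  qed
  have 4: "a * q + N + 1 + (b - al/p) * q - c * q = 0 \<longleftrightarrow> c = N + 1 + a + b - (N + 1 + al) / p"
    unfolding 1 using pq by auto
  show ?thesis using 2 3 4 by blast
qed

lemma kerS_eq: "kerS n a1 a2 b1 b2 c1 c2 zw ue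
    = of_real (ker1 n a1 b1 c1 (fst zw) (fst ue) * ker1 n a2 b2 c2 (snd zw) (snd ue))"
  by (simp add: kerS_def ker1_def powr_minus field_simps split: prod.splits)

text \<open>For a real exponent the modulus of a principal power is the power of the modulus, so the
  modulus of \<open>kerT\<close> is \<open>kerS\<close>.\<close>

lemma norm_kerT: "norm (kerT n a1 a2 b1 b2 c1 c2 zw ue)
    = ker1 n a1 b1 c1 (fst zw) (fst ue) * ker1 n a2 b2 c2 (snd zw) (snd ue)"
  by (simp add: kerT_def ker1_def powr_minus field_simps norm_mult norm_divide norm_powr_real_powr' split: prod.splits)

lemma space_VB2: "space (VB2 n) = TB n \<times> TB n"
  by (simp add: VB2_def space_pair_measure space_VB)

lemma bounded_kerS_if:
  assumes n: "n \<ge> 1" and p: "1 < p1" "1 < p2"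
    and c1: "a1 > 0" "al1 + 1 < p1 * (b1 + 1)" "c1 = real n + 1 + a1 + b1 - (real n + 1 + al1) / p1"
    and c2: "a2 > 0" "al2 + 1 < p2 * (b2 + 1)" "c2 = real n + 1 + a2 + b2 - (real n + 1 + al2) / p2"
  shows "bounded_mixed_to_Linf n p1 p2 al1 al2 (kerS n a1 a2 b1 b2 c1 c2)"
proof -
  define q1 where "q1 = p1 / (p1 - 1)"
  define q2 where "q2 = p2 / (p2 - 1)"
  have pq1: "p1 > 1" "q1 > 1" "1/p1 + 1/q1 = 1" using p by (auto simp: q1_def field_simps)
  have pq2: "p2 > 1" "q2 > 1" "1/p2 + 1/q2 = 1" using p by (auto simp: q2_def field_simps)
  \<comment> \<open>The vanishing exponent makes the dual norm of the kernel factor independent of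
    the point, and the two inequalities make it finite.\<close>
  note e1 = exponent_conditions[OF pq1, of a1 "real n" b1 al1 c1, THEN iffD2, OF conjI[OF c1(1) conjI[OF c1(2,3)]]]
  note e2 = exponent_conditions[OF pq2, of a2 "real n" b2 al2 c2, THEN iffD2, OF conjI[OF c2(1) conjI[OF c2(2,3)]]]
  define N1 where "N1 = epow (FR_const n ((b1 - al1/p1) * q1) (c1 * q1)) (1/q1)"
  define N2 where "N2 = epow (FR_const n ((b2 - al2/p2) * q2) (c2 * q2)) (1/q2)"
  have fin: "N1 < top" "N2 < top"
    unfolding N1_def N2_def epow_less_top_iff using FR_const_finite[OF n] e1 e2 by auto
  define C where "C = enn2real (N1 * N2)"
  have C: "ennreal C = N1 * N2" unfolding C_def using fin by (simp add: ennreal_mult_less_top)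
  have main: "integrable (VB2 n) (\<lambda>ue. kerS n a1 a2 b1 b2 c1 c2 zw ue * f ue) \<and>
      ennreal (norm (intop n (kerS n a1 a2 b1 b2 c1 c2) f zw)) \<le> ennreal C * mixed_norm n p1 p2 al1 al2 f"
    if f [measurable]: "f \<in> borel_measurable (VB2 n)" and fn: "mixed_norm n p1 p2 al1 al2 f < \<infinity>" and zw: "zw \<in> space (VB2 n)"
    for f zw
  proof -
    obtain z w where zw': "zw = (z, w)" "z \<in> TB n" "w \<in> TB n" using zw by (auto simp: space_VB2)
    have [measurable]: "(\<lambda>ue. kerS n a1 a2 b1 b2 c1 c2 zw ue) \<in> borel_measurable (VB2 n)"
      unfolding kerS_eq VB2_def using n by measurable
    have "(\<integral>\<^sup>+ue. ennreal (norm (kerS n a1 a2 b1 b2 c1 c2 zw ue * f ue)) \<partial>VB2 n)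
       = (\<integral>\<^sup>+ue. ennreal (ker1 n a1 b1 c1 z (fst ue) * ker1 n a2 b2 c2 w (snd ue) * norm (f ue)) \<partial>VB2 n)"
      by (intro nn_integral_cong) (simp add: kerS_eq norm_mult zw' ker1_nonneg)
    also have "\<dots> \<le> N1 * N2 * mixed_norm n p1 p2 al1 al2 f"
    proof -
      have "(\<integral>\<^sup>+u. ennreal ((ker1 n a1 b1 c1 z u * rho n u powr (-al1/p1)) powr q1) \<partial>VB n) = FR_const n ((b1 - al1/p1) * q1) (c1 * q1)"
        unfolding ker1_Lq[OF n pq1 zw'(2)] using e1 zw'(2) by (simp add: TB_def)
      moreover have "(\<integral>\<^sup>+u. ennreal ((ker1 n a2 b2 c2 w u * rho n u powr (-al2/p2)) powr q2) \<partial>VB n) = FR_const n ((b2 - al2/p2) * q2) (c2 * q2)"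
        unfolding ker1_Lq[OF n pq2 zw'(3)] using e2 zw'(3) by (simp add: TB_def)
      ultimately show ?thesis
        using mixed_Holder[OF n pq1 pq2 f ker1_measurable[OF n] ker1_measurable[OF n] ker1_nonneg ker1_nonneg, of a1 b1 c1 z a2 b2 c2 w al1 al2]
        by (simp add: N1_def N2_def)
    qed
    finally have le: "(\<integral>\<^sup>+ue. ennreal (norm (kerS n a1 a2 b1 b2 c1 c2 zw ue * f ue)) \<partial>VB2 n) \<le> ennreal C * mixed_norm n p1 p2 al1 al2 f"
      by (simp add: C)
    also have "\<dots> < \<infinity>" using fn by (simp add: ennreal_mult_less_top)
    finally have int: "integrable (VB2 n) (\<lambda>ue. kerS n a1 a2 b1 b2 c1 c2 zw ue * f ue)"
      by (intro integrableI_bounded) auto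
    then show ?thesis
      unfolding intop_def using integral_norm_bound_ennreal[OF int] le by (auto intro: order_trans)
  qed
  then show ?thesis unfolding bounded_mixed_to_Linf_def
    by (intro exI[of _ C]) (auto intro!: AE_I2)
qed

lemma kerT_measurable:
  assumes "n \<ge> 1"
  shows "kerT n a1 a2 b1 b2 c1 c2 zw \<in> borel_measurable (VB2 n)"
  unfolding kerT_def[abs_def] VB2_def split_beta' using assms by measurable

text \<open>S applied to the modulus of \<open>f\<close> dominates T applied to \<open>f\<close>,
  and passing to the modulus preserves the mixed norm.\<close>

lemma bounded_kerT_if_kerS:
  assumes n: "n \<ge> 1" and S: "bounded_mixed_to_Linf n p1 p2 al1 al2 (kerS n a1 a2 b1 b2 c1 c2)"
  shows "bounded_mixed_to_Linf n p1 p2 al1 al2 (kerT n a1 a2 b1 b2 c1 c2)"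
proof -
  let ?S = "kerS n a1 a2 b1 b2 c1 c2" and ?T = "kerT n a1 a2 b1 b2 c1 c2" and ?N = "mixed_norm n p1 p2 al1 al2"
  obtain C where C: "\<And>f. f \<in> borel_measurable (VB2 n) \<Longrightarrow> ?N f < \<infinity> \<Longrightarrow>
      (AE zw in VB2 n. integrable (VB2 n) (\<lambda>ue. ?S zw ue * f ue)) \<and>
      (AE zw in VB2 n. ennreal (norm (intop n ?S f zw)) \<le> ennreal C * ?N f)"
    using S unfolding bounded_mixed_to_Linf_def by blast
  show ?thesis unfolding bounded_mixed_to_Linf_def
  proof (intro exI[of _ C] ballI impI)
    fix f assume f [measurable]: "f \<in> borel_measurable (VB2 n)" and fn: "?N f < \<infinity>"
    define g where "g ue = complex_of_real (norm (f ue))" for ue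
    have [measurable]: "g \<in> borel_measurable (VB2 n)" unfolding g_def[abs_def] by measurable
    have Ng: "?N g = ?N f" by (simp add: mixed_norm_def g_def)
    note Cg = C[of g, unfolded Ng, OF _ fn]
    have eq: "?S zw ue * g ue = of_real (norm (?T zw ue * f ue))" for zw ue
      by (simp add: kerS_eq norm_mult norm_kerT g_def)
    have int: "integrable (VB2 n) (\<lambda>ue. ?T zw ue * f ue)" if "integrable (VB2 n) (\<lambda>ue. ?S zw ue * g ue)" for zw
      by (rule Bochner_Integration.integrable_bound[OF that])
         (auto simp: eq kerT_measurable[OF n] intro!: borel_measurable_times AE_I2)
    have bd: "norm (intop n ?T f zw) \<le> norm (intop n ?S g zw)" if "integrable (VB2 n) (\<lambda>ue. ?S zw ue * g ue)" for zw
    proof -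
      have "norm (intop n ?T f zw) \<le> (\<integral>ue. norm (?T zw ue * f ue) \<partial>VB2 n)"
        unfolding intop_def by (rule integral_norm_bound)
      also have "\<dots> = norm (intop n ?S g zw)"
        unfolding intop_def eq by (simp del: norm_mult add: integral_complex_of_real)
      finally show ?thesis .
    qed
    show "(AE zw in VB2 n. integrable (VB2 n) (\<lambda>ue. ?T zw ue * f ue)) \<and>
          (AE zw in VB2 n. ennreal (norm (intop n ?T f zw)) \<le> ennreal C * ?N f)"
    proof
      show "AE zw in VB2 n. integrable (VB2 n) (\<lambda>ue. ?T zw ue * f ue)"
        using Cg int by auto
      have "AE zw in VB2 n. integrable (VB2 n) (\<lambda>ue. ?S zw ue * g ue)"
        "AE zw in VB2 n. ennreal (norm (intop n ?S g zw)) \<le> ennreal C * ?N f" using Cg by auto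
      then show "AE zw in VB2 n. ennreal (norm (intop n ?T f zw)) \<le> ennreal C * ?N f"
        by eventually_elim (use bd ennreal_leI order_trans in blast)
    qed
  qed
qed

section \<open>Local stability of the kernel\<close>

text \<open>A lower bound independent of \<open>u\<close>, needed to turn additive errors into
  errors relative to \<open>rho2\<close>.\<close>

lemma half_rho_le_norm_rho2: "u \<in> TB n \<Longrightarrow> rho n z / 2 \<le> cmod (rho2 n z u)"
proof -
  assume u: "u \<in> TB n"
  define D where "D = (\<Sum>j<n-1. (cmod (z j - u j))\<^sup>2)"
  have "D \<ge> 0" unfolding D_def by (simp add: sum_nonneg)
  then have "rho n z / 2 \<le> Re (rho2 n z u)" unfolding Re_rho2 D_def[symmetric]
    using u unfolding TB_def by (auto simp: add_divide_distrib)
  also have "\<dots> \<le> cmod (rho2 n z u)" by (rule complex_Re_le_cmod)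
  finally show ?thesis .
qed

text \<open>The square of the left side is at most \<open>4 * Re (rho2 n z u)\<close>, and a number
  is at most 1 plus its square. This controls the growth in the unbounded variable
  \<open>u\<close>.\<close>

lemma norm_diff_le_norm_rho2:
  assumes "z \<in> TB n" "u \<in> TB n" "j < n - 1"
  shows "cmod (z j - u j) \<le> 1 + 4 * cmod (rho2 n z u)"
proof -
  have "(cmod (z j - u j))\<^sup>2 \<le> (\<Sum>j<n-1. (cmod (z j - u j))\<^sup>2)"
    using assms by (intro member_le_sum) auto
  also have "\<dots> \<le> 4 * Re (rho2 n z u)" unfolding Re_rho2 using assms by (simp add: TB_def)
  also have "\<dots> \<le> 4 * cmod (rho2 n z u)" using complex_Re_le_cmod[of "rho2 n z u"] by simp
  finally have "(cmod (z j - u j))\<^sup>2 \<le> 4 * cmod (rho2 n z u)" .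
  moreover have "cmod (z j - u j) \<le> 1 + (cmod (z j - u j))\<^sup>2"
    using zero_le_power2[of "cmod (z j - u j) - 1/2"] by (simp add: power2_eq_square algebra_simps)
  ultimately show ?thesis by linarith
qed

definition l1dist :: "nat \<Rightarrow> (nat \<Rightarrow> complex) \<Rightarrow> (nat \<Rightarrow> complex) \<Rightarrow> real" where
  "l1dist n z0 z = (\<Sum>j<n. cmod (z j - z0 j))"

lemma l1dist_split: "n \<ge> 1 \<Longrightarrow> l1dist n z0 z = (\<Sum>j<n-1. cmod (z j - z0 j)) + cmod (z (n-1) - z0 (n-1))"
  unfolding l1dist_def by (cases n) auto

lemma norm_diff_le_l1dist: "j < n \<Longrightarrow> cmod (z j - z0 j) \<le> l1dist n z0 z"
  unfolding l1dist_def by (rule member_le_sum) auto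

lemma rho_perturb:
  assumes n: "n \<ge> 1" and d: "l1dist n z0 z \<le> 1"
  shows "\<bar>rho n z - rho n z0\<bar> \<le> (2 + 2 * (\<Sum>j<n. \<bar>Im (z0 j)\<bar>)) * l1dist n z0 z"
proof -
  define Y where "Y = (\<Sum>j<n. \<bar>Im (z0 j)\<bar>)"
  define d where "d = l1dist n z0 z"
  have d1: "d \<le> 1" using d by (simp add: d_def)
  have Y: "\<bar>Im (z0 j)\<bar> \<le> Y" if "j < n" for j unfolding Y_def by (rule member_le_sum) (use that in auto)
  have Y0: "Y \<ge> 0" unfolding Y_def by (simp add: sum_nonneg)
  \<comment> \<open>The factor \<open>1 + 2 * Y\<close> bounds the sum of the two imaginary parts,
    which differ by at most 1.\<close>
  have step: "\<bar>(Im (z j))\<^sup>2 - (Im (z0 j))\<^sup>2\<bar> \<le> (1 + 2 * Y) * cmod (z j - z0 j)" if "j < n - 1" for j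
  proof -
    have Yj: "\<bar>Im (z0 j)\<bar> \<le> Y" using Y that by simp
    have "\<bar>Im (z j) - Im (z0 j)\<bar> \<le> cmod (z j - z0 j)" using abs_Im_le_cmod[of "z j - z0 j"] by simp
    moreover have "cmod (z j - z0 j) \<le> 1" using norm_diff_le_l1dist[of j n z z0] that d by linarith
    ultimately have i: "\<bar>Im (z j) - Im (z0 j)\<bar> \<le> cmod (z j - z0 j)" "\<bar>Im (z j) + Im (z0 j)\<bar> \<le> 1 + 2 * Y"
      using Yj by auto
    have "(Im (z j))\<^sup>2 - (Im (z0 j))\<^sup>2 = (Im (z j) + Im (z0 j)) * (Im (z j) - Im (z0 j))"
      by (simp add: power2_eq_square algebra_simps)
    then show ?thesis using i Y0 by (auto simp: abs_mult intro!: mult_mono)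
  qed
  have "\<bar>rho n z - rho n z0\<bar> = \<bar>(Im (z (n-1)) - Im (z0 (n-1))) - (\<Sum>j<n-1. (Im (z j))\<^sup>2 - (Im (z0 j))\<^sup>2)\<bar>"
    unfolding rho_def sum_subtractf by (simp add: algebra_simps)
  also have "\<dots> \<le> \<bar>Im (z (n-1)) - Im (z0 (n-1))\<bar> + \<bar>\<Sum>j<n-1. (Im (z j))\<^sup>2 - (Im (z0 j))\<^sup>2\<bar>"
    by (rule abs_triangle_ineq4)
  also have "\<bar>Im (z (n-1)) - Im (z0 (n-1))\<bar> \<le> cmod (z (n-1) - z0 (n-1))"
    using abs_Im_le_cmod[of "z (n-1) - z0 (n-1)"] by simp
  also have "\<dots> \<le> d" unfolding d_def using n by (intro norm_diff_le_l1dist) simp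
  also have "\<bar>\<Sum>j<n-1. (Im (z j))\<^sup>2 - (Im (z0 j))\<^sup>2\<bar> \<le> (\<Sum>j<n-1. \<bar>(Im (z j))\<^sup>2 - (Im (z0 j))\<^sup>2\<bar>)"
    by (rule sum_abs)
  also have "\<dots> \<le> (\<Sum>j<n-1. (1 + 2 * Y) * cmod (z j - z0 j))" by (intro sum_mono step) simp
  also have "\<dots> = (1 + 2 * Y) * (\<Sum>j<n-1. cmod (z j - z0 j))" by (simp add: sum_distrib_left)
  also have "\<dots> \<le> (1 + 2 * Y) * d"
    unfolding d_def l1dist_split[OF n] using Y0 by (intro mult_left_mono) auto
  finally show ?thesis unfolding Y_def[symmetric] d_def[symmetric] by (simp add: algebra_simps)
qed

text \<open>The relative form makes the estimate uniform on the unbounded domain: \<open>u\<close>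
  enters the difference at most linearly, its growth is controlled by
  \<open>norm_diff_le_norm_rho2\<close>, and the constants are absorbed by
  \<open>half_rho_le_norm_rho2\<close>.\<close>

lemma rho2_perturb:
  assumes n: "n \<ge> 1" and z0: "z0 \<in> TB n"
  obtains L where "L > 0" "\<And>z u. l1dist n z0 z \<le> 1 \<Longrightarrow> u \<in> TB n \<Longrightarrow>
    cmod (rho2 n z u - rho2 n z0 u) \<le> L * l1dist n z0 z * cmod (rho2 n z0 u)"
proof -
  define Y where "Y = (\<Sum>j<n. \<bar>Im (z0 j)\<bar>)"
  have Y: "\<bar>Im (z0 j)\<bar> \<le> Y" if "j < n" for j unfolding Y_def by (rule member_le_sum) (use that in auto)
  have Y0: "Y \<ge> 0" unfolding Y_def by (simp add: sum_nonneg)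
  define m where "m = rho n z0 / 2"
  have m: "m > 0" using z0 by (simp add: m_def TB_def)
  \<comment> \<open>The squares give \<open>7 + 4 * Y\<close> and the last coordinate gives
    \<open>2\<close>; since \<open>m <= R\<close>, division by \<open>m\<close> makes this sum
    relative to \<open>R\<close>. The \<open>24\<close> is already a coefficient of
    \<open>R\<close>, and the final \<open>4\<close> is the prefactor of
    \<open>rho2\<close>.\<close>
  define L where "L = ((9 + 4 * Y) / m + 24) / 4"
  have L: "L > 0" unfolding L_def using m Y0 by (simp add: add_nonneg_pos)
  show ?thesis
  proof (rule that[OF L])
    fix z u assume d: "l1dist n z0 z \<le> 1" and u: "u \<in> TB n"
    define d where "d = l1dist n z0 z"
    define R where "R = cmod (rho2 n z0 u)"
    have R: "m \<le> R" unfolding m_def R_def by (rule half_rho_le_norm_rho2[OF u])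
    have d0: "d \<ge> 0" unfolding d_def l1dist_def by (simp add: sum_nonneg)
    have step: "cmod ((z j - cnj (u j))\<^sup>2 - (z0 j - cnj (u j))\<^sup>2) \<le> (7 + 24 * R + 4 * Y) * cmod (z j - z0 j)" if j: "j < n - 1" for j
    proof -
      have 1: "cmod (z j - z0 j) \<le> 1" using norm_diff_le_l1dist[of j n z z0] j d by linarith
      have 2: "cmod (z0 j - u j) \<le> 1 + 4 * R" unfolding R_def using norm_diff_le_norm_rho2[OF z0 u j] .
      have 3: "\<bar>Im (u j)\<bar> \<le> Y + cmod (z0 j - u j)"
      proof -
        have "\<bar>Im (z0 j)\<bar> \<le> Y" using Y j by simp
        then show ?thesis using abs_Im_le_cmod[of "z0 j - u j"] by auto
      qed
      have 4: "cmod (u j - cnj (u j)) = 2 * \<bar>Im (u j)\<bar>" by (simp add: complex_diff_cnj norm_mult)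
      \<comment> \<open>Each piece has a bound by now: \<open>1\<close>, \<open>1 + 4 * R\<close>
        and twice \<open>Y + 1 + 4 * R\<close>, where the last two count double. The total is
        \<open>7 + 24 * R + 4 * Y\<close>.\<close>
      have "z j + z0 j - 2 * cnj (u j) = (z j - z0 j) + 2 * ((z0 j - u j) + (u j - cnj (u j)))" by simp
      also have "cmod \<dots> \<le> cmod (z j - z0 j) + 2 * (cmod (z0 j - u j) + cmod (u j - cnj (u j)))"
      proof (rule order_trans[OF norm_triangle_ineq], rule add_left_mono)
        show "cmod (2 * ((z0 j - u j) + (u j - cnj (u j)))) \<le> 2 * (cmod (z0 j - u j) + cmod (u j - cnj (u j)))"
          unfolding norm_mult using norm_triangle_ineq[of "z0 j - u j" "u j - cnj (u j)"] by simp
      qed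
      also have "\<dots> \<le> 7 + 24 * R + 4 * Y" using 1 2 3 unfolding 4 by argo
      finally have 5: "cmod (z j + z0 j - 2 * cnj (u j)) \<le> 7 + 24 * R + 4 * Y" .
      have "(z j - cnj (u j))\<^sup>2 - (z0 j - cnj (u j))\<^sup>2 = (z j + z0 j - 2 * cnj (u j)) * (z j - z0 j)"
        by (simp add: power2_eq_square algebra_simps)
      then show ?thesis using 5 by (simp add: norm_mult mult_right_mono)
    qed
    have eq: "rho2 n z u - rho2 n z0 u = (1/4) * ((\<Sum>j<n-1. (z j - cnj (u j))\<^sup>2 - (z0 j - cnj (u j))\<^sup>2) - 2 * \<i> * (z (n-1) - z0 (n-1)))"
      unfolding rho2_def sum_subtractf by (simp add: algebra_simps)
    have "cmod (rho2 n z u - rho2 n z0 u) = (1/4) * cmod ((\<Sum>j<n-1. (z j - cnj (u j))\<^sup>2 - (z0 j - cnj (u j))\<^sup>2) - 2 * \<i> * (z (n-1) - z0 (n-1)))"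
      unfolding eq by (simp add: norm_mult)
    also have "\<dots> \<le> (1/4) * (cmod (\<Sum>j<n-1. (z j - cnj (u j))\<^sup>2 - (z0 j - cnj (u j))\<^sup>2) + cmod (2 * \<i> * (z (n-1) - z0 (n-1))))"
      by (intro mult_left_mono norm_triangle_ineq4) simp
    also have "cmod (2 * \<i> * (z (n-1) - z0 (n-1))) = 2 * cmod (z (n-1) - z0 (n-1))" by (simp add: norm_mult)
    also have "cmod (\<Sum>j<n-1. (z j - cnj (u j))\<^sup>2 - (z0 j - cnj (u j))\<^sup>2) \<le> (\<Sum>j<n-1. (7 + 24 * R + 4 * Y) * cmod (z j - z0 j))"
      by (rule sum_norm_le) (use step in auto)
    also have "\<dots> = (7 + 24 * R + 4 * Y) * (\<Sum>j<n-1. cmod (z j - z0 j))" by (simp add: sum_distrib_left)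
    also have "\<dots> \<le> (7 + 24 * R + 4 * Y) * d"
      unfolding d_def l1dist_split[OF n] using Y0 R m by (intro mult_left_mono) auto
    also have "cmod (z (n-1) - z0 (n-1)) \<le> d" unfolding d_def using n by (intro norm_diff_le_l1dist) simp
    finally have "cmod (rho2 n z u - rho2 n z0 u) \<le> d * ((9 + 4 * Y) + 24 * R) / 4" by (simp add: algebra_simps)
    also have "\<dots> \<le> d * ((9 + 4 * Y) / m * R + 24 * R) / 4"
    proof -
      have "(9 + 4 * Y) * 1 \<le> (9 + 4 * Y) * (R / m)" using m R Y0 by (intro mult_left_mono) auto
      then show ?thesis using d0 by (intro divide_right_mono mult_left_mono add_right_mono) auto
    qed
    also have "\<dots> = L * d * R" by (simp add: L_def algebra_simps)
    finally show "cmod (rho2 n z u - rho2 n z0 u) \<le> L * l1dist n z0 z * cmod (rho2 n z0 u)"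
      by (simp add: d_def R_def)
  qed
qed

text \<open>Both arguments lie strictly between -pi/2 and pi/2, so their difference stays in the
  principal strip and no branch jump occurs.\<close>

lemma powr_divide_Re_pos:
  fixes a b c :: complex
  assumes "Re a > 0" "Re b > 0"
  shows "(a / b) powr (-c) = b powr c / a powr c"
proof -
  have nz: "a \<noteq> 0" "b \<noteq> 0" using assms by auto
  have "\<bar>Im (Ln a)\<bar> < pi/2" "\<bar>Im (Ln b)\<bar> < pi/2" using assms Re_Ln_pos_lt nz by blast+
  then have lnq: "Ln (a / b) = Ln a - Ln b"
    by (intro Ln_unique) (auto simp: exp_diff nz)
  show ?thesis unfolding powr_def lnq using nz by (simp add: algebra_simps flip: exp_diff)
qed

text \<open>Used at two levels: for the two powers within a one-variable kernel quotient, and for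
  the product of the quotients in both variables.\<close>

lemma norm_mult_minus_1_le:
  fixes x y :: complex
  assumes "cmod (x - 1) \<le> s" "cmod (y - 1) \<le> s"
  shows "cmod (x * y - 1) \<le> 2 * s + s * s"
proof -
  have "x * y - 1 = (x - 1) + (y - 1) + (x - 1) * (y - 1)" by (simp add: algebra_simps)
  also have "cmod \<dots> \<le> cmod (x - 1) + cmod (y - 1) + cmod (x - 1) * cmod (y - 1)"
    by (metis norm_mult norm_triangle_ineq norm_triangle_mono order_refl)
  also have "\<dots> \<le> s + s + s * s" using assms by (intro add_mono mult_mono) (auto intro: order_trans[OF norm_ge_zero])
  finally show ?thesis by simp
qed

definition kerT1 :: "nat \<Rightarrow> real \<Rightarrow> real \<Rightarrow> real \<Rightarrow> (nat \<Rightarrow> complex) \<Rightarrow> (nat \<Rightarrow> complex) \<Rightarrow> complex" where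
  "kerT1 n a b c z u = of_real (rho n z powr a * rho n u powr b) / rho2 n z u powr of_real c"

lemma kerT_eq: "kerT n a1 a2 b1 b2 c1 c2 zw ue = kerT1 n a1 b1 c1 (fst zw) (fst ue) * kerT1 n a2 b2 c2 (snd zw) (snd ue)"
  by (simp add: kerT_def kerT1_def field_simps split: prod.splits)

lemma kerT1_nonzero: "z \<in> TB n \<Longrightarrow> u \<in> TB n \<Longrightarrow> kerT1 n a b c z u \<noteq> 0"
  using Re_rho2_pos[of z n u] by (auto simp: kerT1_def TB_def powr_def)

lemma l1_ball_positive_measure:
  assumes n: "n \<ge> 1" and d: "d > 0"
  shows "{z \<in> space (Cn n). l1dist n z0 z < d} \<in> sets (Cn n)"
    and "emeasure (Cn n) {z \<in> space (Cn n). l1dist n z0 z < d} > 0"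
proof -
  have [measurable]: "l1dist n z0 \<in> borel_measurable (Cn n)"
    unfolding l1dist_def[abs_def] Cn_def by measurable
  show *: "{z \<in> space (Cn n). l1dist n z0 z < d} \<in> sets (Cn n)" by measurable
  \<comment> \<open>The polydisc of radius \<open>d / n\<close> in each of the \<open>n\<close>
    coordinates lies in the l1 ball, and its measure is a product.\<close>
  define B where "B = PiE {..<n} (\<lambda>j. ball (z0 j) (d / real n))"
  have ball: "emeasure lborel (ball z (d / real n)) \<noteq> 0" for z :: complex
  proof -
    have "measure lborel (ball z (d / real n)) > 0" using n d by (intro content_ball_pos) simp
    then show ?thesis by (auto simp: measure_def)
  qed
  have "emeasure (Cn n) B = (\<Prod>j<n. emeasure lborel (ball (z0 j) (d / real n)))"
    unfolding B_def Cn_def by (rule PC.emeasure_PiM) auto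
  also have "\<dots> \<noteq> 0" using ball by simp
  finally have "emeasure (Cn n) B > 0" by (simp add: zero_less_iff_neq_zero)
  also have "emeasure (Cn n) B \<le> emeasure (Cn n) {z \<in> space (Cn n). l1dist n z0 z < d}"
  proof (intro emeasure_mono *)
    show "B \<subseteq> {z \<in> space (Cn n). l1dist n z0 z < d}"
    proof
      fix z assume z: "z \<in> B"
      have "l1dist n z0 z < (\<Sum>j<n. d / real n)"
        unfolding l1dist_def
        by (rule sum_strict_mono) (use z n in \<open>auto simp: B_def PiE_iff dist_norm norm_minus_commute lessThan_empty_iff\<close>)
      also have "\<dots> = d" using n by simp
      finally show "z \<in> {z \<in> space (Cn n). l1dist n z0 z < d}" using z by (auto simp: B_def Cn_def space_PiM)
    qed
  qed
  finally show "emeasure (Cn n) {z \<in> space (Cn n). l1dist n z0 z < d} > 0" .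
qed

text \<open>The kernel quotient is a power of \<open>rho n z / rho n z0\<close> times a power of
  \<open>rho2 n z u / rho2 n z0 u\<close>, and both quotients are close to 1 uniformly in
  \<open>u\<close>. The neighbourhood needs positive measure because boundedness gives information
  only almost everywhere.\<close>

lemma kerT1_near:
  assumes n: "n \<ge> 1" and z0: "z0 \<in> TB n"
  obtains U where "U \<in> sets (VB n)" "emeasure (VB n) U > 0" "U \<subseteq> TB n"
    "\<And>z u. z \<in> U \<Longrightarrow> u \<in> TB n \<Longrightarrow> cmod (kerT1 n a b c z u / kerT1 n a b c z0 u - 1) \<le> 1/4"
proof -
  have r0: "rho n z0 > 0" using z0 by (simp add: TB_def)
  obtain L where L: "L > 0" "\<And>z u. l1dist n z0 z \<le> 1 \<Longrightarrow> u \<in> TB n \<Longrightarrow>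
    cmod (rho2 n z u - rho2 n z0 u) \<le> L * l1dist n z0 z * cmod (rho2 n z0 u)"
    using rho2_perturb[OF n z0] by blast
  define K where "K = 2 + 2 * (\<Sum>j<n. \<bar>Im (z0 j)\<bar>)"
  have K: "K > 0" unfolding K_def by (simp add: add_pos_nonneg sum_nonneg)
  have "((\<lambda>x::real. complex_of_real (x powr a)) \<longlongrightarrow> of_real (1 powr a)) (nhds 1)"
    by (intro tendsto_intros filterlim_ident) auto
  then have "\<forall>\<^sub>F x in nhds (1::real). dist (complex_of_real (x powr a)) (of_real (1 powr a)) < 1/10"
    by (rule tendstoD) simp
  then obtain e1 where e1: "e1 > 0" "\<And>x. \<bar>x - 1\<bar> < e1 \<Longrightarrow> cmod (complex_of_real (x powr a) - 1) < 1/10"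
    unfolding eventually_nhds_metric by (auto simp: dist_norm)
  have "((\<lambda>x::complex. x powr (- of_real c)) \<longlongrightarrow> 1 powr (- of_real c)) (nhds 1)"
    by (intro tendsto_powr_complex tendsto_intros filterlim_ident) auto
  then have "\<forall>\<^sub>F x in nhds (1::complex). dist (x powr (- of_real c)) (1 powr (- of_real c)) < 1/10"
    by (rule tendstoD) simp
  then obtain e2 where e2: "e2 > 0" "\<And>x. cmod (x - 1) < e2 \<Longrightarrow> cmod (x powr (- of_real c) - 1) < 1/10"
    unfolding eventually_nhds_metric by (auto simp: dist_norm)
  \<comment> \<open>In this order the entries make the perturbation lemmas applicable, bring the
    quotient of \<open>rho2\<close> within \<open>e2\<close> of 1 and that of \<open>rho\<close>
    within \<open>e1\<close> of 1, and keep \<open>rho n z\<close> positive.\<close>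
  define d where "d = Min {1, e2 / L, e1 * rho n z0 / K, rho n z0 / K}"
  have d: "d > 0" "d \<le> 1" "d \<le> e2 / L" "d \<le> e1 * rho n z0 / K" "d \<le> rho n z0 / K"
    using L K e1 e2 r0 by (auto simp: d_def)
  define U where "U = {z \<in> space (Cn n). l1dist n z0 z < d}"
  have near: "K * l1dist n z0 z < rho n z0" "K * l1dist n z0 z < e1 * rho n z0" "L * l1dist n z0 z < e2" "l1dist n z0 z \<le> 1" if "z \<in> U" for z
  proof -
    have "l1dist n z0 z < d" using that by (simp add: U_def)
    then have "l1dist n z0 z < rho n z0 / K" "l1dist n z0 z < e1 * rho n z0 / K" "l1dist n z0 z < e2 / L" "l1dist n z0 z \<le> 1"
      using d by linarith+
    then show "K * l1dist n z0 z < rho n z0" "K * l1dist n z0 z < e1 * rho n z0" "L * l1dist n z0 z < e2" "l1dist n z0 z \<le> 1"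
      using K L by (auto simp: field_simps)
  qed
  have rd: "\<bar>rho n z - rho n z0\<bar> \<le> K * l1dist n z0 z" if "z \<in> U" for z
    unfolding K_def by (rule rho_perturb[OF n near(4)[OF that]])
  have UTB: "U \<subseteq> TB n"
  proof
    fix z assume z: "z \<in> U"
    have "rho n z > 0" using rd[OF z] near(1)[OF z] by linarith
    then show "z \<in> TB n" using z by (simp add: TB_def U_def)
  qed
  note U = l1_ball_positive_measure[OF n d(1), of z0, folded U_def]
  have "U \<in> sets (VB n)" using U(1) UTB n by (simp add: VB_def sets_restrict_space_iff)
  moreover have "emeasure (VB n) U > 0" using U UTB n by (simp add: VB_def emeasure_restrict_space)
  moreover note UTB
  moreover have "cmod (kerT1 n a b c z u / kerT1 n a b c z0 u - 1) \<le> 1/4" if z: "z \<in> U" and u: "u \<in> TB n" for z u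
  proof -
    have zT: "z \<in> TB n" using z UTB by auto
    have pos: "Re (rho2 n z u) > 0" "Re (rho2 n z0 u) > 0" "rho n z > 0" "rho n u > 0"
      using Re_rho2_pos zT u z0 by (auto simp: TB_def)
    then have nz: "rho2 n z0 u \<noteq> 0" "rho2 n z u \<noteq> 0" by auto
    have eq: "kerT1 n a b c z u / kerT1 n a b c z0 u = of_real ((rho n z / rho n z0) powr a) * (rho2 n z u / rho2 n z0 u) powr (- of_real c)"
      unfolding powr_divide_Re_pos[OF pos(1,2)] kerT1_def using pos r0 nz by (simp add: powr_divide field_simps)
    have "\<bar>rho n z / rho n z0 - 1\<bar> = \<bar>rho n z - rho n z0\<bar> / rho n z0"
      using r0 by (simp add: diff_divide_distrib[symmetric] abs_divide field_simps)
    also have "\<dots> < e1" using rd[OF z] near(2)[OF z] r0 by (simp add: divide_less_eq)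
    finally have 1: "cmod (complex_of_real ((rho n z / rho n z0) powr a) - 1) < 1/10" by (rule e1(2))
    have "cmod (rho2 n z u / rho2 n z0 u - 1) = cmod (rho2 n z u - rho2 n z0 u) / cmod (rho2 n z0 u)"
      using nz by (simp add: norm_divide[symmetric] diff_divide_distrib)
    also have "\<dots> \<le> L * l1dist n z0 z" using L(2)[OF near(4)[OF z] u] nz by (simp add: divide_le_eq)
    also have "\<dots> < e2" by (rule near(3)[OF z])
    finally have 2: "cmod ((rho2 n z u / rho2 n z0 u) powr (- of_real c) - 1) < 1/10" by (rule e2(2))
    \<comment> \<open>The tolerance \<open>1/10\<close> was chosen so that
      \<open>2/10 + 1/100\<close> stays below \<open>1/4\<close>.\<close>
    have "cmod (kerT1 n a b c z u / kerT1 n a b c z0 u - 1) \<le> 2 * (1/10) + (1/10) * (1/10)"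
      unfolding eq by (rule norm_mult_minus_1_le) (use 1 2 in auto)
    then show ?thesis by simp
  qed
  ultimately show ?thesis by (rule that)
qed

section \<open>Necessity\<close>

text \<open>Only the modulus of \<open>f\<close> is prescribed, so that a test function may carry
  the phase of a kernel.\<close>

lemma mixed_norm_product:
  assumes n: "n \<ge> 1" and p: "p1 > 1" "p2 > 1"
    and [measurable]: "g1 \<in> borel_measurable (VB n)" "g2 \<in> borel_measurable (VB n)"
    and g0: "\<And>u. g1 u \<ge> 0" "\<And>u. g2 u \<ge> (0::real)"
    and f: "\<And>u e. u \<in> TB n \<Longrightarrow> e \<in> TB n \<Longrightarrow> norm (f (u, e)) = g1 u * g2 e"
  shows "mixed_norm n p1 p2 al1 al2 f = epow (\<integral>\<^sup>+u. ennreal (g1 u powr p1 * rho n u powr al1) \<partial>VB n) (1/p1)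
     * epow (\<integral>\<^sup>+u. ennreal (g2 u powr p2 * rho n u powr al2) \<partial>VB n) (1/p2)"
proof -
  note [measurable] = rho_measurable_VB[OF n]
  define X1 where "X1 = (\<integral>\<^sup>+u. ennreal (g1 u powr p1 * rho n u powr al1) \<partial>VB n)"
  define X2 where "X2 = (\<integral>\<^sup>+u. ennreal (g2 u powr p2 * rho n u powr al2) \<partial>VB n)"
  have inner: "(\<integral>\<^sup>+u. ennreal (norm (f (u, e)) powr p1 * rho n u powr al1) \<partial>VB n) = ennreal (g2 e powr p1) * X1"
    if "e \<in> space (VB n)" for e
  proof -
    have "(\<integral>\<^sup>+u. ennreal (norm (f (u, e)) powr p1 * rho n u powr al1) \<partial>VB n)
       = (\<integral>\<^sup>+u. ennreal (g2 e powr p1) * ennreal (g1 u powr p1 * rho n u powr al1) \<partial>VB n)"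
      using that g0 by (intro nn_integral_cong) (simp add: space_VB f powr_mult ennreal_mult'[symmetric] mult_ac)
    also have "\<dots> = ennreal (g2 e powr p1) * X1" unfolding X1_def by (rule nn_integral_cmult) measurable
    finally show ?thesis .
  qed
  have "(\<integral>\<^sup>+e. epow (\<integral>\<^sup>+u. ennreal (norm (f (u, e)) powr p1 * rho n u powr al1) \<partial>VB n) (p2/p1) * ennreal (rho n e powr al2) \<partial>VB n)
    = (\<integral>\<^sup>+e. epow X1 (p2/p1) * ennreal (g2 e powr p2 * rho n e powr al2) \<partial>VB n)"
    using p g0 by (intro nn_integral_cong, unfold inner) (simp add: epow_mult epow_ennreal powr_powr ennreal_mult' mult_ac)
  also have "\<dots> = epow X1 (p2/p1) * X2" unfolding X2_def by (rule nn_integral_cmult) measurable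
  finally have "mixed_norm n p1 p2 al1 al2 f = epow (epow X1 (p2/p1) * X2) (1/p2)"
    unfolding mixed_norm_def by simp
  also have "\<dots> = epow X1 (1/p1) * epow X2 (1/p2)" using p by (simp add: epow_mult epow_epow)
  finally show ?thesis by (simp add: X1_def X2_def)
qed

lemma AE_ex_in_positive:
  assumes "AE x in M. P x" "A \<in> sets M" "emeasure M A > 0"
  shows "\<exists>x\<in>A. P x"
proof (rule ccontr)
  assume "\<not> ?thesis"
  then have "AE x in M. x \<notin> A" using assms(1) by (auto elim!: eventually_mono)
  then have "emeasure M A = 0" using assms(2) by (simp add: AE_iff_null_sets null_setsD1)
  then show False using assms(3) by simp
qed

text \<open>The inequality holds at every \<open>z\<close> and \<open>w\<close>: the operator is
  evaluated at a nearby point where the almost-everywhere statements hold, and stability of the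
  kernel carries the bound back.\<close>

lemma bounded_kerT_test:
  assumes n: "n \<ge> 1" and p: "p1 > 1" "p2 > 1"
    and T: "bounded_mixed_to_Linf n p1 p2 al1 al2 (kerT n a1 a2 b1 b2 c1 c2)"
  obtains C where "C \<ge> 0" "\<And>z w g1 g2. z \<in> TB n \<Longrightarrow> w \<in> TB n \<Longrightarrow>
     g1 \<in> borel_measurable (VB n) \<Longrightarrow> g2 \<in> borel_measurable (VB n) \<Longrightarrow> (\<And>u. g1 u \<ge> 0) \<Longrightarrow> (\<And>u. g2 u \<ge> 0) \<Longrightarrow>
     (\<integral>\<^sup>+u. ennreal (g1 u powr p1 * rho n u powr al1) \<partial>VB n) < \<infinity> \<Longrightarrow>
     (\<integral>\<^sup>+u. ennreal (g2 u powr p2 * rho n u powr al2) \<partial>VB n) < \<infinity> \<Longrightarrow>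
     (\<integral>\<^sup>+u. ennreal (ker1 n a1 b1 c1 z u * g1 u) \<partial>VB n) * (\<integral>\<^sup>+u. ennreal (ker1 n a2 b2 c2 w u * g2 u) \<partial>VB n)
      \<le> ennreal C * (epow (\<integral>\<^sup>+u. ennreal (g1 u powr p1 * rho n u powr al1) \<partial>VB n) (1/p1)
           * epow (\<integral>\<^sup>+u. ennreal (g2 u powr p2 * rho n u powr al2) \<partial>VB n) (1/p2))"
proof -
  let ?T = "kerT n a1 a2 b1 b2 c1 c2" and ?N = "mixed_norm n p1 p2 al1 al2"
  interpret V: sigma_finite_measure "VB n" by (rule sigma_finite_VB[OF n])
  interpret pair_sigma_finite "VB n" "VB n" by standard
  obtain C where C: "\<And>f. f \<in> borel_measurable (VB2 n) \<Longrightarrow> ?N f < \<infinity> \<Longrightarrow>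
      (AE zw in VB2 n. integrable (VB2 n) (\<lambda>ue. ?T zw ue * f ue)) \<and>
      (AE zw in VB2 n. ennreal (norm (intop n ?T f zw)) \<le> ennreal C * ?N f)"
    using T unfolding bounded_mixed_to_Linf_def by blast
  \<comment> \<open>The factor \<open>16/7\<close> undoes the loss of \<open>7/16\<close> below; the
    maximum is taken because \<open>C\<close> may be negative.\<close>
  define C' where "C' = 16/7 * max C 0"
  show ?thesis
  proof (rule that[of C'])
    show "C' \<ge> 0" by (simp add: C'_def)
    fix z0 w0 g1 g2
    assume z0: "z0 \<in> TB n" and w0: "w0 \<in> TB n"
      and g [measurable]: "g1 \<in> borel_measurable (VB n)" "g2 \<in> borel_measurable (VB n)"
      and g0: "\<And>u. g1 u \<ge> (0::real)" "\<And>u. g2 u \<ge> (0::real)"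
      and fin: "(\<integral>\<^sup>+u. ennreal (g1 u powr p1 * rho n u powr al1) \<partial>VB n) < \<infinity>"
         "(\<integral>\<^sup>+u. ennreal (g2 u powr p2 * rho n u powr al2) \<partial>VB n) < \<infinity>"
    define k where "k = ?T (z0, w0)"
    have [measurable]: "k \<in> borel_measurable (VB2 n)" unfolding k_def by (rule kerT_measurable[OF n])
    note [measurable] = ker1_measurable[OF n]
    have g' [measurable]: "(\<lambda>ue. g1 (fst ue)) \<in> borel_measurable (VB2 n)" "(\<lambda>ue. g2 (snd ue)) \<in> borel_measurable (VB2 n)"
      unfolding VB2_def by measurable
    \<comment> \<open>The phase of \<open>f\<close> cancels that of \<open>k\<close>. As
      \<open>k\<close> has no zeros on the domain, the modulus of \<open>f\<close> there is the
      product of \<open>g1\<close> and \<open>g2\<close>.\<close>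
    define f where "f ue = cnj (k ue) / of_real (cmod (k ue)) * of_real (g1 (fst ue) * g2 (snd ue))" for ue
    have f_meas: "f \<in> borel_measurable (VB2 n)" unfolding f_def[abs_def] by measurable
    have k_nz: "k (u, e) \<noteq> 0" if "u \<in> TB n" "e \<in> TB n" for u e
      unfolding k_def kerT_eq using kerT1_nonzero that z0 w0 by simp
    have k_norm: "cmod (k ue) = ker1 n a1 b1 c1 z0 (fst ue) * ker1 n a2 b2 c2 w0 (snd ue)" for ue
      unfolding k_def norm_kerT by simp
    have Nf: "?N f = epow (\<integral>\<^sup>+u. ennreal (g1 u powr p1 * rho n u powr al1) \<partial>VB n) (1/p1)
     * epow (\<integral>\<^sup>+u. ennreal (g2 u powr p2 * rho n u powr al2) \<partial>VB n) (1/p2)"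
      by (rule mixed_norm_product[OF n p g g0]) (use k_nz g0 in \<open>auto simp: f_def norm_mult norm_divide\<close>)
    have Nfin: "?N f < \<infinity>" unfolding Nf using fin by (simp add: ennreal_mult_less_top epow_less_top_iff)
    obtain U where U: "U \<in> sets (VB n)" "emeasure (VB n) U > 0" "U \<subseteq> TB n"
      "\<And>z u. z \<in> U \<Longrightarrow> u \<in> TB n \<Longrightarrow> cmod (kerT1 n a1 b1 c1 z u / kerT1 n a1 b1 c1 z0 u - 1) \<le> 1/4"
      using kerT1_near[OF n z0] by blast
    obtain W where W: "W \<in> sets (VB n)" "emeasure (VB n) W > 0" "W \<subseteq> TB n"
      "\<And>z u. z \<in> W \<Longrightarrow> u \<in> TB n \<Longrightarrow> cmod (kerT1 n a2 b2 c2 z u / kerT1 n a2 b2 c2 w0 u - 1) \<le> 1/4"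
      using kerT1_near[OF n w0] by blast
    have "U \<times> W \<in> sets (VB2 n)" unfolding VB2_def using U W by simp
    moreover have "emeasure (VB2 n) (U \<times> W) > 0" unfolding VB2_def
      using U W by (simp add: V.emeasure_pair_measure_Times ennreal_zero_less_mult_iff)
    moreover have "AE zw in VB2 n. integrable (VB2 n) (\<lambda>ue. ?T zw ue * f ue) \<and> ennreal (norm (intop n ?T f zw)) \<le> ennreal C * ?N f"
      using C[OF f_meas Nfin] by (auto elim!: eventually_elim2)
    ultimately obtain z w where zw: "z \<in> U" "w \<in> W" "integrable (VB2 n) (\<lambda>ue. ?T (z, w) ue * f ue)"
        "ennreal (norm (intop n ?T f (z, w))) \<le> ennreal C * ?N f"
      using AE_ex_in_positive[of "\<lambda>zw. integrable (VB2 n) (\<lambda>ue. ?T zw ue * f ue) \<and> ennreal (norm (intop n ?T f zw)) \<le> ennreal C * ?N f" "VB2 n" "U \<times> W"] by auto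
    define h where "h ue = cmod (k ue) * (g1 (fst ue) * g2 (snd ue))" for ue
    have h0: "h ue \<ge> 0" for ue unfolding h_def using g0 by simp
    \<comment> \<open>Two quotients within \<open>1/4\<close> of 1 have a product within
      \<open>9/16\<close> of 1, hence with real part at least \<open>7/16\<close>.\<close>
    have Re_ge: "7/16 * h ue \<le> Re (?T (z, w) ue * f ue)" if ue_space: "ue \<in> space (VB2 n)" for ue
    proof -
      obtain u e where ue: "ue = (u, e)" "u \<in> TB n" "e \<in> TB n" using ue_space by (auto simp: space_VB2)
      define q where "q = (kerT1 n a1 b1 c1 z u / kerT1 n a1 b1 c1 z0 u) * (kerT1 n a2 b2 c2 w e / kerT1 n a2 b2 c2 w0 e)"
      have "cmod (q - 1) \<le> 2 * (1/4) + (1/4) * (1/4)" unfolding q_def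
        by (rule norm_mult_minus_1_le) (use U(4)[OF zw(1)] W(4)[OF zw(2)] ue in auto)
      then have q: "Re q \<ge> 7/16" using abs_Re_le_cmod[of "q - 1"] by auto
      have "?T (z, w) ue = q * k ue"
        unfolding q_def k_def kerT_eq using kerT1_nonzero z0 w0 ue by simp
      then have "?T (z, w) ue * f ue = q * (k ue * cnj (k ue) / of_real (cmod (k ue))) * of_real (g1 u * g2 e)"
        by (simp add: f_def ue)
      also have "k ue * cnj (k ue) / of_real (cmod (k ue)) = of_real (cmod (k ue))"
        using k_nz[OF ue(2,3)] unfolding complex_norm_square[symmetric] ue(1) by (simp add: power2_eq_square)
      finally have "?T (z, w) ue * f ue = q * of_real (h ue)" by (simp add: h_def ue)
      then show ?thesis using mult_right_mono[OF q h0[of ue]] by simp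
    qed
    have h_eq: "(\<integral>\<^sup>+ue. ennreal (h ue) \<partial>VB2 n) = (\<integral>\<^sup>+u. ennreal (ker1 n a1 b1 c1 z0 u * g1 u) \<partial>VB n) * (\<integral>\<^sup>+u. ennreal (ker1 n a2 b2 c2 w0 u * g2 u) \<partial>VB n)"
    proof -
      have "(\<integral>\<^sup>+ue. ennreal (h ue) \<partial>VB2 n) = (\<integral>\<^sup>+ue. ennreal (ker1 n a1 b1 c1 z0 (fst ue) * g1 (fst ue)) * ennreal (ker1 n a2 b2 c2 w0 (snd ue) * g2 (snd ue)) \<partial>VB2 n)"
        using g0 ker1_nonneg by (intro nn_integral_cong) (simp add: h_def k_norm ennreal_mult'[symmetric] mult_ac)
      also have "\<dots> = (\<integral>\<^sup>+e. (\<integral>\<^sup>+u. ennreal (ker1 n a1 b1 c1 z0 u * g1 u) * ennreal (ker1 n a2 b2 c2 w0 e * g2 e) \<partial>VB n) \<partial>VB n)"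
        unfolding VB2_def by (subst nn_integral_snd[symmetric]) simp_all
      also have "\<dots> = (\<integral>\<^sup>+e. (\<integral>\<^sup>+u. ennreal (ker1 n a1 b1 c1 z0 u * g1 u) \<partial>VB n) * ennreal (ker1 n a2 b2 c2 w0 e * g2 e) \<partial>VB n)"
        by (intro nn_integral_cong nn_integral_multc) measurable
      also have "\<dots> = (\<integral>\<^sup>+u. ennreal (ker1 n a1 b1 c1 z0 u * g1 u) \<partial>VB n) * (\<integral>\<^sup>+u. ennreal (ker1 n a2 b2 c2 w0 u * g2 u) \<partial>VB n)"
        by (rule nn_integral_cmult) measurable
      finally show ?thesis .
    qed
    have hm [measurable]: "h \<in> borel_measurable (VB2 n)" unfolding h_def[abs_def] by measurable
    have "ennreal (7/16) * (\<integral>\<^sup>+ue. ennreal (h ue) \<partial>VB2 n) = (\<integral>\<^sup>+ue. ennreal (7/16 * h ue) \<partial>VB2 n)"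
      by (subst nn_integral_cmult[symmetric]) (auto simp: ennreal_mult'[symmetric])
    also have "\<dots> \<le> (\<integral>\<^sup>+ue. ennreal (Re (?T (z, w) ue * f ue)) \<partial>VB2 n)"
      by (intro nn_integral_mono ennreal_leI Re_ge)
    also have "\<dots> = ennreal (\<integral>ue. Re (?T (z, w) ue * f ue) \<partial>VB2 n)"
    proof (rule nn_integral_eq_integral)
      show "integrable (VB2 n) (\<lambda>ue. Re (?T (z, w) ue * f ue))" by (rule integrable_Re[OF zw(3)])
      show "AE ue in VB2 n. 0 \<le> Re (?T (z, w) ue * f ue)"
        using Re_ge h0 by (intro AE_I2) (meson divide_nonneg_nonneg mult_nonneg_nonneg order_trans zero_le_numeral)
    qed
    also have "(\<integral>ue. Re (?T (z, w) ue * f ue) \<partial>VB2 n) = Re (intop n ?T f (z, w))"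
      unfolding intop_def by (rule integral_Re[OF zw(3)])
    also have "ennreal \<dots> \<le> ennreal (norm (intop n ?T f (z, w)))" by (intro ennreal_leI complex_Re_le_cmod)
    also have "\<dots> \<le> ennreal C * ?N f" by (rule zw(4))
    finally have le: "ennreal (7/16) * (\<integral>\<^sup>+ue. ennreal (h ue) \<partial>VB2 n) \<le> ennreal C * ?N f" .
    have "(\<integral>\<^sup>+ue. ennreal (h ue) \<partial>VB2 n) = ennreal (16/7) * (ennreal (7/16) * (\<integral>\<^sup>+ue. ennreal (h ue) \<partial>VB2 n))"
      unfolding mult.assoc[symmetric] by (subst ennreal_mult[symmetric]) auto
    also have "\<dots> \<le> ennreal (16/7) * (ennreal (max C 0) * ?N f)"
      by (intro mult_left_mono order_trans[OF le] mult_right_mono ennreal_leI) auto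
    also have "\<dots> = ennreal C' * ?N f" unfolding C'_def by (subst ennreal_mult) (simp_all add: mult.assoc)
    finally show "(\<integral>\<^sup>+u. ennreal (ker1 n a1 b1 c1 z0 u * g1 u) \<partial>VB n) * (\<integral>\<^sup>+u. ennreal (ker1 n a2 b2 c2 w0 u * g2 u) \<partial>VB n)
      \<le> ennreal C' * (epow (\<integral>\<^sup>+u. ennreal (g1 u powr p1 * rho n u powr al1) \<partial>VB n) (1/p1)
           * epow (\<integral>\<^sup>+u. ennreal (g2 u powr p2 * rho n u powr al2) \<partial>VB n) (1/p2))"
      unfolding h_eq Nf .
  qed
qed

section \<open>Test functions and reduction to one variable\<close>

lemma ex_TB_rho:
  assumes "n \<ge> 1" "x > 0"
  obtains z where "z \<in> TB n" "rho n z = x"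
proof -
  define z where "z = (\<lambda>j\<in>{..<n}. if j = n - 1 then \<i> * of_real x else 0)"
  have z: "rho n z = x" using assms by (auto simp: rho_def z_def intro!: sum.neutral)
  then have "z \<in> TB n" using assms by (auto simp: TB_def z_def Cn_def space_PiM)
  then show ?thesis using z that by blast
qed

text \<open>Supplies the function to be frozen in one variable. A power of \<open>rho2 n w u\<close>
  works, since the Forelli-Rudin formula evaluates both its norm and its pairing with the kernel;
  the pairing may be infinite.\<close>

lemma ex_test_function:
  assumes n: "n \<ge> 1" and p: "p > 1" and al: "al > -1"
  obtains w g where "w \<in> TB n" "g \<in> borel_measurable (VB n)" "\<And>u. g u \<ge> (0::real)"
    "(\<integral>\<^sup>+u. ennreal (g u powr p * rho n u powr al) \<partial>VB n) < \<infinity>"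
    "(\<integral>\<^sup>+u. ennreal (ker1 n a b c w u * g u) \<partial>VB n) > 0"
proof -
  obtain w where w: "w \<in> TB n" "rho n w = 1" using ex_TB_rho[OF n, of 1] by auto
  \<comment> \<open>With this choice \<open>r * p\<close> exceeds the convergence threshold
    \<open>n + 1 + al\<close> by exactly 1.\<close>
  define r where "r = (real n + 2 + al) / p"
  define g where "g u = cmod (rho2 n w u) powr (-r)" for u
  have gm: "g \<in> borel_measurable (VB n)" unfolding g_def[abs_def] using n by measurable
  have rp: "r * p = real n + 2 + al" using p by (simp add: r_def)
  have "(\<integral>\<^sup>+u. ennreal (g u powr p * rho n u powr al) \<partial>VB n) = (\<integral>\<^sup>+u. ennreal (rho n u powr al * cmod (rho2 n w u) powr (-(r * p))) \<partial>VB n)"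
    by (simp add: g_def powr_powr mult.commute)
  also have "\<dots> = FR_const n al (r * p)" unfolding Forelli_Rudin[OF n w(1)] w(2) by simp
  also have "\<dots> < \<infinity>" using n al rp by (intro FR_const_finite) auto
  finally have 1: "(\<integral>\<^sup>+u. ennreal (g u powr p * rho n u powr al) \<partial>VB n) < \<infinity>" .
  have "(\<integral>\<^sup>+u. ennreal (ker1 n a b c w u * g u) \<partial>VB n) = (\<integral>\<^sup>+u. ennreal (rho n u powr b * cmod (rho2 n w u) powr (-(c + r))) \<partial>VB n)"
    unfolding ker1_def g_def w(2) by (intro nn_integral_cong arg_cong[where f=ennreal]) (simp add: powr_add[symmetric] add.commute)
  also have "\<dots> = FR_const n b (c + r)" unfolding Forelli_Rudin[OF n w(1)] w(2) by simp
  finally have 2: "(\<integral>\<^sup>+u. ennreal (ker1 n a b c w u * g u) \<partial>VB n) > 0" using FR_const_pos by simp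
  show ?thesis by (rule that[OF w(1) gm _ 1 2]) (simp add: g_def)
qed

text \<open>\<open>Y\<close> may be infinite, so it is first replaced by a finite positive lower
  bound by which one can divide. That \<open>D\<close> is independent of \<open>A\<close> and
  \<open>B\<close> gives uniformity in the remaining test function.\<close>

lemma ennreal_factor_bound:
  fixes Y :: ennreal
  assumes "Y > 0" "E < \<infinity>" "C \<ge> 0"
  obtains D where "D \<ge> 0" "\<And>A B. A * Y \<le> ennreal C * (B * E) \<Longrightarrow> A \<le> ennreal D * B"
proof -
  obtain y where y: "y > 0" "ennreal y \<le> Y"
    using assms(1) by (cases Y) (auto intro: that[of 1])
  obtain e where e: "E = ennreal e" "e \<ge> 0" using assms(2) by (cases E) auto
  show ?thesis
  proof (rule that[of "C * e / y"])
    show "C * e / y \<ge> 0" using y e assms by simp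
    fix A B :: ennreal assume "A * Y \<le> ennreal C * (B * E)"
    moreover have "A * ennreal y \<le> A * Y" using y by (intro mult_left_mono) auto
    ultimately have le: "A * ennreal y \<le> ennreal C * (B * E)" by (rule order_trans[rotated])
    have "A = ennreal (1/y) * (A * ennreal y)"
    proof -
      have "ennreal (1/y) * ennreal y = 1" using y by (simp add: ennreal_mult'[symmetric])
      then show ?thesis by (metis mult.left_commute mult.right_neutral)
    qed
    also have "\<dots> \<le> ennreal (1/y) * (ennreal C * (B * E))" by (intro mult_left_mono le) simp
    also have "\<dots> = ennreal (C * e / y) * B"
    proof -
      have "ennreal (C * e / y) = ennreal (1/y) * ennreal C * ennreal e"
        using y e assms by (simp add: ennreal_mult'[symmetric] ennreal_mult[symmetric])
      then show ?thesis by (simp add: e mult_ac)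
    qed
    finally show "A \<le> ennreal (C * e / y) * B" .
  qed
qed

text \<open>The converse of Hoelder's inequality bounds the dual norm uniformly in \<open>z\<close>.
  By \<open>ker1_Lq\<close> its q-th power is a constant times a power of \<open>rho n z\<close>; as
  \<open>rho\<close> takes every positive value, the constant is finite and the exponent is
  zero.\<close>

lemma ker1_dual_bound_necessary:
  assumes n: "n \<ge> 1" and p: "p > 1" and D: "D \<ge> 0"
    and bnd: "\<And>z g. z \<in> TB n \<Longrightarrow> g \<in> borel_measurable (VB n) \<Longrightarrow> (\<And>u. g u \<ge> (0::real)) \<Longrightarrow>
       (\<integral>\<^sup>+u. ennreal (g u powr p * rho n u powr al) \<partial>VB n) < \<infinity> \<Longrightarrow>
       (\<integral>\<^sup>+u. ennreal (ker1 n a b c z u * g u) \<partial>VB n) \<le> ennreal D * epow (\<integral>\<^sup>+u. ennreal (g u powr p * rho n u powr al) \<partial>VB n) (1/p)"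
  shows "a > 0 \<and> al + 1 < p * (b + 1) \<and> c = real n + 1 + a + b - (real n + 1 + al) / p"
proof -
  define q where "q = p / (p - 1)"
  have pq: "p > 1" "q > 1" "1/p + 1/q = 1" using p by (auto simp: q_def field_simps)
  define s where "s = (b - al/p) * q"
  define E where "E = a * q + real n + 1 + s - c * q"
  note [measurable] = ker1_measurable[OF n] rho_measurable_VB[OF n]
  have bound: "FR_const n s (c * q) * ennreal (rho n z powr E) \<le> ennreal (D powr q)" if z: "z \<in> TB n" for z
  proof -
    have "(\<integral>\<^sup>+u. ennreal ((ker1 n a b c z u * rho n u powr (-al/p)) powr q) \<partial>VB n) \<le> ennreal (D powr q)"
    proof (rule nn_integral_converse_Holder[OF sigma_finite_VB[OF n] pq D])
      show "(\<lambda>u. ker1 n a b c z u * rho n u powr (-al/p)) \<in> borel_measurable (VB n)" by measurable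
      show "0 \<le> ker1 n a b c z u * rho n u powr (-al/p)" for u by (simp add: ker1_nonneg)
      fix g :: "(nat \<Rightarrow> complex) \<Rightarrow> real"
      assume [measurable]: "g \<in> borel_measurable (VB n)" and g0: "\<And>u. g u \<ge> 0"
        and fin: "(\<integral>\<^sup>+u. ennreal (g u powr p) \<partial>VB n) < \<infinity>"
      \<comment> \<open>Multiplication by this power preserves the norm when passing from the
        unweighted space to the one with weight \<open>rho powr al\<close>.\<close>
      define g1 where "g1 u = g u * rho n u powr (-al/p)" for u
      have [measurable]: "g1 \<in> borel_measurable (VB n)" unfolding g1_def[abs_def] by measurable
      have N: "(\<integral>\<^sup>+u. ennreal (g1 u powr p * rho n u powr al) \<partial>VB n) = (\<integral>\<^sup>+u. ennreal (g u powr p) \<partial>VB n)"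
      proof (intro nn_integral_cong)
        fix u assume "u \<in> space (VB n)"
        then have "rho n u > 0" by (simp add: space_VB TB_def)
        then have "(rho n u powr (-al/p)) powr p * rho n u powr al = 1"
          unfolding powr_powr powr_add[symmetric] using p by simp
        then show "ennreal (g1 u powr p * rho n u powr al) = ennreal (g u powr p)"
          unfolding g1_def powr_mult by (simp only: mult.assoc mult_1_right)
      qed
      have A: "(\<integral>\<^sup>+u. ennreal (ker1 n a b c z u * rho n u powr (-al/p) * g u) \<partial>VB n) = (\<integral>\<^sup>+u. ennreal (ker1 n a b c z u * g1 u) \<partial>VB n)"
        by (simp add: g1_def mult_ac)
      show "(\<integral>\<^sup>+u. ennreal (ker1 n a b c z u * rho n u powr (-al/p) * g u) \<partial>VB n) \<le> ennreal D * epow (\<integral>\<^sup>+u. ennreal (g u powr p) \<partial>VB n) (1/p)"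
        unfolding A N[symmetric] by (rule bnd[OF z]) (use g0 fin N in \<open>auto simp: g1_def\<close>)
    qed
    then show ?thesis unfolding ker1_Lq[OF n pq z] by (simp add: E_def s_def)
  qed
  obtain z1 where z1: "z1 \<in> TB n" "rho n z1 = 1" using ex_TB_rho[OF n, of 1] by auto
  have "FR_const n s (c * q) \<le> ennreal (D powr q)" using bound[OF z1(1)] z1 by simp
  then have FRfin: "FR_const n s (c * q) < \<infinity>" by (rule order_le_less_trans) simp
  obtain F where F: "FR_const n s (c * q) = ennreal F" "F > 0"
    using FRfin FR_const_pos[of n s "c * q"] by (cases "FR_const n s (c * q)") auto
  have "E = 0"
  proof (rule ccontr)
    assume E: "E \<noteq> 0"
    \<comment> \<open>Chosen so that \<open>F * x powr E = D powr q + 1\<close>, one more than the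
      bound allows; this covers both signs of \<open>E\<close>.\<close>
    define x where "x = ((D powr q + 1) / F) powr (1 / E)"
    have pos: "(D powr q + 1) / F > 0" using F by (simp add: add_nonneg_pos)
    have x: "x > 0" unfolding x_def powr_gt_zero using pos by (rule less_imp_neq[symmetric])
    obtain z where z: "z \<in> TB n" "rho n z = x" using ex_TB_rho[OF n x] by auto
    have "x powr E = (D powr q + 1) / F" unfolding x_def powr_powr using E pos F(2) by simp
    then have "ennreal F * ennreal ((D powr q + 1) / F) \<le> ennreal (D powr q)"
      using bound[OF z(1)] F(1) z(2) by simp
    moreover have "ennreal F * ennreal ((D powr q + 1) / F) = ennreal (D powr q + 1)"
      using F(2) by (simp flip: ennreal_mult' del: ennreal_plus)
    ultimately show False by (simp add: ennreal_le_iff del: ennreal_plus)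
  qed
  then show ?thesis
    using exponent_conditions[OF pq, of a "real n" b al c] FR_const_finiteD[OF FRfin]
    unfolding E_def s_def by auto
qed

text \<open>Freezing a test function in one variable turns the product inequality of
  \<open>bounded_kerT_test\<close> into a one-variable bound in the other.\<close>

lemma bounded_kerT_necessary:
  assumes n: "n \<ge> 1" and p: "p1 > 1" "p2 > 1" and al: "al1 > -1" "al2 > -1"
    and T: "bounded_mixed_to_Linf n p1 p2 al1 al2 (kerT n a1 a2 b1 b2 c1 c2)"
  shows "a1 > 0 \<and> al1 + 1 < p1 * (b1 + 1) \<and> c1 = real n + 1 + a1 + b1 - (real n + 1 + al1) / p1" (is ?t1)
    and "a2 > 0 \<and> al2 + 1 < p2 * (b2 + 1) \<and> c2 = real n + 1 + a2 + b2 - (real n + 1 + al2) / p2" (is ?t2)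
proof -
  define N1 where "N1 g = (\<integral>\<^sup>+u. ennreal (g u powr p1 * rho n u powr al1) \<partial>VB n)" for g
  define N2 where "N2 g = (\<integral>\<^sup>+u. ennreal (g u powr p2 * rho n u powr al2) \<partial>VB n)" for g
  define A1 where "A1 z g = (\<integral>\<^sup>+u. ennreal (ker1 n a1 b1 c1 z u * g u) \<partial>VB n)" for z g
  define A2 where "A2 z g = (\<integral>\<^sup>+u. ennreal (ker1 n a2 b2 c2 z u * g u) \<partial>VB n)" for z g
  obtain C where C: "C \<ge> 0" and bnd: "\<And>z w g1 g2. z \<in> TB n \<Longrightarrow> w \<in> TB n \<Longrightarrow>
     g1 \<in> borel_measurable (VB n) \<Longrightarrow> g2 \<in> borel_measurable (VB n) \<Longrightarrow> (\<And>u. g1 u \<ge> 0) \<Longrightarrow> (\<And>u. g2 u \<ge> 0) \<Longrightarrow>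
     N1 g1 < \<infinity> \<Longrightarrow> N2 g2 < \<infinity> \<Longrightarrow>
     A1 z g1 * A2 w g2 \<le> ennreal C * (epow (N1 g1) (1/p1) * epow (N2 g2) (1/p2))"
    unfolding N1_def N2_def A1_def A2_def using bounded_kerT_test[OF n p T] by blast
  show ?t1
  proof -
    obtain w g2 where g2: "w \<in> TB n" "g2 \<in> borel_measurable (VB n)" "\<And>u. g2 u \<ge> 0" "N2 g2 < \<infinity>" "A2 w g2 > 0"
      using ex_test_function[OF n p(2) al(2)] unfolding N2_def A2_def by blast
    have "epow (N2 g2) (1/p2) < \<infinity>" using g2(4) by (simp add: epow_less_top_iff)
    then obtain D where D: "D \<ge> 0" "\<And>A B. A * A2 w g2 \<le> ennreal C * (B * epow (N2 g2) (1/p2)) \<Longrightarrow> A \<le> ennreal D * B"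
      using ennreal_factor_bound[OF g2(5) _ C] by blast
    show ?thesis
      by (rule ker1_dual_bound_necessary[OF n p(1) D(1)], fold A1_def N1_def, rule D(2), rule bnd) (use g2 in auto)
  qed
  show ?t2
  proof -
    obtain w g1 where g1: "w \<in> TB n" "g1 \<in> borel_measurable (VB n)" "\<And>u. g1 u \<ge> 0" "N1 g1 < \<infinity>" "A1 w g1 > 0"
      using ex_test_function[OF n p(1) al(1)] unfolding N1_def A1_def by blast
    have "epow (N1 g1) (1/p1) < \<infinity>" using g1(4) by (simp add: epow_less_top_iff)
    then obtain D where D: "D \<ge> 0" "\<And>A B. A * A1 w g1 \<le> ennreal C * (B * epow (N1 g1) (1/p1)) \<Longrightarrow> A \<le> ennreal D * B"
      using ennreal_factor_bound[OF g1(5) _ C] by blast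
    show ?thesis
    proof (rule ker1_dual_bound_necessary[OF n p(2) D(1)], fold A2_def N2_def, rule D(2))
      fix z g assume "z \<in> TB n" "g \<in> borel_measurable (VB n)" "\<And>u. 0 \<le> g u" "N2 g < \<infinity>"
      then have "A1 w g1 * A2 z g \<le> ennreal C * (epow (N1 g1) (1/p1) * epow (N2 g) (1/p2))"
        by (intro bnd) (use g1 in auto)
      then show "A2 z g * A1 w g1 \<le> ennreal C * (epow (N2 g) (1/p2) * epow (N1 g1) (1/p1))"
        by (simp add: mult.commute)
    qed
  qed
qed

theorem theorem6p5:
  fixes n :: nat and p1 p2 a1 a2 b1 b2 c1 c2 al1 al2 :: real
  assumes "n \<ge> 1"
    and "1 < p1" and "1 < p2"
    and "al1 > -1" and "al2 > -1"
  shows "(bounded_mixed_to_Linf n p1 p2 al1 al2 (kerS n a1 a2 b1 b2 c1 c2)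
            \<longleftrightarrow> bounded_mixed_to_Linf n p1 p2 al1 al2 (kerT n a1 a2 b1 b2 c1 c2))
       \<and> (bounded_mixed_to_Linf n p1 p2 al1 al2 (kerT n a1 a2 b1 b2 c1 c2)
            \<longleftrightarrow> (a1 > 0 \<and> al1 + 1 < p1 * (b1 + 1) \<and> c1 = n + 1 + a1 + b1 - (n + 1 + al1) / p1
               \<and> a2 > 0 \<and> al2 + 1 < p2 * (b2 + 1) \<and> c2 = n + 1 + a2 + b2 - (n + 1 + al2) / p2))"
    (is "(?S \<longleftrightarrow> ?T) \<and> (?T \<longleftrightarrow> ?C)")
proof -
  have "?S" if c: ?C
    by (rule bounded_kerS_if) (use assms c in auto)
  moreover have "?T" if ?S
    by (rule bounded_kerT_if_kerS[OF assms(1) that])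
  moreover have "?C" if ?T
    using bounded_kerT_necessary[OF assms that] by (simp add: add_ac)
  ultimately show ?thesis by blast
qed

end
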